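(* Let $n\in\mathbb{N}$, $\mathbb{A}=(A_1,\dots,A_n)\in\mathbb{P}^n$ and $\omega=(w_1,\dots,w_n)\in\Delta_n$. Then for $0\le t<z\le1$: (i) $\mathcal{R}_{t,z}(\omega;\mathbb{A})^{\frac{1}{1-t}} \preceq Q_{1-t}(\omega;\mathbb{A})$ when $\mathcal{R}_{t,z}(\omega;\mathbb{A})\le I$; (ii) $\mathcal{R}_{t,z}(\omega;\mathbb{A})^{\frac{1}{1-t}} \succeq Q_{1-t}(\omega;\mathbb{A})$ when $\mathcal{R}_{t,z}(\omega;\mathbb{A})\ge I$.
   Context: $\mathbb{P}$ is the open convex cone of positive definite (positive and invertible) bounded linear operators on a Hilbert space. The Loewner order $X \le Y$ on self-adjoint operators means $Y - X$ is positive semi-definite. The metric geometric mean is $A \# B = A^{1/2}(A^{-1/2} B A^{-1/2})^{1/2}A^{1/2}$ for $A,B\in\mathbb{P}$. The near-order on $\mathbb{P}$ is defined by: $A \preceq B$ (equivalently written $B\succeq A$) if and only if $A^{-1}\# B \ge I$. $\Delta_n$ is the set of probability vectors in $\mathbb{R}^n$ with all entries positive. For $p\neq0$, $Q_p(\omega;\mathbb{A}) = \left(\sum_{j=1}^n w_j A_j^p\right)^{1/p}$ is the quasi-arithmetic mean. For $0\le t<z\le1$, the R\'enyi power mean $\mathcal{R}_{t,z}(\omega;\mathbb{A})$ is the unique solution $X\in\mathbb{P}$ (known to exist) of the equation $X=\sum_{j=1}^n w_j\left(A_j^{\frac{1-t}{2z}}X^{\frac{t}{z}}A_j^{\frac{1-t}{2z}}\right)^z$.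 *)

theory Defs
  imports "HOL-Analysis.Analysis" "HOL-Computational_Algebra.Polynomial"
begin

section \<open>Complex Hilbert spaces\<close>

text \<open>
  A complex Hilbert space is a complete real inner product space (for the real part of the
  complex inner product) with a compatible complex scalar multiplication and a complex inner
  product, conjugate linear in its first argument. Norm, topology and completeness come from
  \<^class>\<open>real_inner\<close> and \<^class>\<open>complete_space\<close>.
\<close>

class complex_hilbert = real_inner + complete_space +
  fixes scaleC :: "complex \<Rightarrow> 'a \<Rightarrow> 'a"  (infixr "*\<^sub>C" 75)
    and cinner :: "'a \<Rightarrow> 'a \<Rightarrow> complex"
  assumes scaleC_add_right: "c *\<^sub>C (x + y) = c *\<^sub>C x + c *\<^sub>C y"
    and scaleC_add_left: "(c + d) *\<^sub>C x = c *\<^sub>C x + d *\<^sub>C x"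
    and scaleC_scaleC: "c *\<^sub>C (d *\<^sub>C x) = (c * d) *\<^sub>C x"
    and scaleC_of_real: "complex_of_real r *\<^sub>C x = r *\<^sub>R x"
    and cinner_commute: "cinner x y = cnj (cinner y x)"
    and cinner_add_left: "cinner (x + y) z = cinner x z + cinner y z"
    and cinner_scaleC_left: "cinner (c *\<^sub>C x) y = cnj c * cinner x y"
    and Re_cinner: "Re (cinner x y) = inner x y"

instantiation complex :: complex_hilbert
begin

definition scaleC_complex :: "complex \<Rightarrow> complex \<Rightarrow> complex"
  where "scaleC_complex c x = c * x"

definition cinner_complex :: "complex \<Rightarrow> complex \<Rightarrow> complex"
  where "cinner_complex x y = cnj x * y"

instance
  by standard
    (simp_all add: scaleC_complex_def cinner_complex_def inner_complex_def
      algebra_simps scaleR_conv_of_real)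

end

section \<open>Operators\<close>

type_synonym 'a op = "'a \<Rightarrow>\<^sub>L 'a"

text \<open>
  Elements of \<^typ>\<open>'a op\<close> are only real linear; complex linearity is part of
  \<open>pos_semidef\<close> below, hence of every notion built on it.
\<close>

definition clinear_op :: "'a::complex_hilbert op \<Rightarrow> bool"
  where "clinear_op T \<longleftrightarrow> (\<forall>c x. blinfun_apply T (c *\<^sub>C x) = c *\<^sub>C blinfun_apply T x)"

definition is_op_inverse :: "'a::real_normed_vector op \<Rightarrow> 'a op \<Rightarrow> bool"
  where "is_op_inverse T S \<longleftrightarrow> T o\<^sub>L S = id_blinfun \<and> S o\<^sub>L T = id_blinfun"

definition invertible_op :: "'a::real_normed_vector op \<Rightarrow> bool"
  where "invertible_op T \<longleftrightarrow> (\<exists>S. is_op_inverse T S)"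

definition op_inv :: "'a::real_normed_vector op \<Rightarrow> 'a op"
  where "op_inv T = (THE S. is_op_inverse T S)"

text \<open>On a complex Hilbert space a positive semidefinite operator is automatically self-adjoint.\<close>

definition pos_semidef :: "'a::complex_hilbert op \<Rightarrow> bool"
  where "pos_semidef T \<longleftrightarrow> clinear_op T \<and>
    (\<forall>x. cinner x (blinfun_apply T x) \<in> \<real> \<and> 0 \<le> Re (cinner x (blinfun_apply T x)))"

definition pos_def :: "'a::complex_hilbert op \<Rightarrow> bool"
  where "pos_def T \<longleftrightarrow> pos_semidef T \<and> invertible_op T"

definition loewner_le :: "'a::complex_hilbert op \<Rightarrow> 'a op \<Rightarrow> bool"  (infix "\<le>\<^sub>L" 50)
  where "X \<le>\<^sub>L Y \<longleftrightarrow> pos_semidef (Y - X)"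

section \<open>Continuous functional calculus and real powers\<close>

text \<open>
  Everything below is applied to self-adjoint operators only. Their spectrum is a compact set
  of real numbers, so real spectral parameters and real polynomials suffice.
\<close>

definition op_spectrum :: "'a::real_normed_vector op \<Rightarrow> real set"
  where "op_spectrum T = {r. \<not> invertible_op (T - r *\<^sub>R id_blinfun)}"

definition op_power :: "'a::real_normed_vector op \<Rightarrow> nat \<Rightarrow> 'a op"
  where "op_power T k = (((o\<^sub>L) T) ^^ k) id_blinfun"

definition op_poly :: "real poly \<Rightarrow> 'a::real_normed_vector op \<Rightarrow> 'a op"
  where "op_poly p T = (\<Sum>i\<le>degree p. coeff p i *\<^sub>R op_power T i)"

text \<open>
  \<open>op_fun f T\<close> is \<open>f(T)\<close>: the common norm limit of \<open>p\<^sub>k(T)\<close> over all sequences of polynomials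
  \<open>p\<^sub>k\<close> that converge to \<open>f\<close> uniformly on the spectrum of \<open>T\<close>. For self-adjoint \<open>T\<close> and \<open>f\<close>
  continuous on the spectrum such sequences exist (Weierstrass) and the limit is unique.
\<close>

definition op_fun :: "(real \<Rightarrow> real) \<Rightarrow> 'a::real_normed_vector op \<Rightarrow> 'a op"
  where "op_fun f T = (THE S. \<forall>p :: nat \<Rightarrow> real poly.
    uniform_limit (op_spectrum T) (\<lambda>k x. poly (p k) x) f sequentially \<longrightarrow>
    (\<lambda>k. op_poly (p k) T) \<longlonglongrightarrow> S)"

definition op_powr :: "'a::real_normed_vector op \<Rightarrow> real \<Rightarrow> 'a op"
  where "op_powr T s = op_fun (\<lambda>x. x powr s) T"

section \<open>Means and the near-order\<close>

definition geo_mean :: "'a::complex_hilbert op \<Rightarrow> 'a op \<Rightarrow> 'a op"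
  where "geo_mean A B = op_powr A (1/2) o\<^sub>L
    op_powr (op_powr A (-1/2) o\<^sub>L B o\<^sub>L op_powr A (-1/2)) (1/2) o\<^sub>L op_powr A (1/2)"

definition near_le :: "'a::complex_hilbert op \<Rightarrow> 'a op \<Rightarrow> bool"  (infix "\<preceq>\<^sub>N" 50)
  where "A \<preceq>\<^sub>N B \<longleftrightarrow> id_blinfun \<le>\<^sub>L geo_mean (op_inv A) B"

text \<open>
  An \<open>n\<close>-tuple is a function on \<^typ>\<open>nat\<close> whose values outside \<open>{1..n}\<close> are irrelevant.
\<close>

definition prob_vector :: "nat \<Rightarrow> (nat \<Rightarrow> real) \<Rightarrow> bool"
  where "prob_vector n w \<longleftrightarrow> (\<forall>j\<in>{1..n}. 0 < w j) \<and> (\<Sum>j=1..n. w j) = 1"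

definition quasi_mean ::
    "real \<Rightarrow> nat \<Rightarrow> (nat \<Rightarrow> real) \<Rightarrow> (nat \<Rightarrow> 'a::complex_hilbert op) \<Rightarrow> 'a op"
  where "quasi_mean p n w A = op_powr (\<Sum>j=1..n. w j *\<^sub>R op_powr (A j) p) (1/p)"

definition renyi_mean ::
    "real \<Rightarrow> real \<Rightarrow> nat \<Rightarrow> (nat \<Rightarrow> real) \<Rightarrow> (nat \<Rightarrow> 'a::complex_hilbert op) \<Rightarrow> 'a op"
  where "renyi_mean t z n w A = (THE X. pos_def X \<and>
    X = (\<Sum>j=1..n. w j *\<^sub>R
      op_powr (op_powr (A j) ((1 - t) / (2 * z)) o\<^sub>L op_powr X (t / z)
               o\<^sub>L op_powr (A j) ((1 - t) / (2 * z))) z))"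

end

theory Submission
  imports Defs "HOL-Computational_Algebra.Fundamental_Theorem_Algebra"
begin

text \<open>
  Write \<open>X\<close> for the Renyi mean and \<open>F\<close> for the map of which it is the fixed point,
  \<open>F X = \<Sum>\<^sub>j w\<^sub>j (A\<^sub>j\<^bsup>a\<^esup> X\<^bsup>t/z\<^esup> A\<^sub>j\<^bsup>a\<^esup>)\<^bsup>z\<^esup>\<close> with \<open>a = (1 - t) / (2 z)\<close>. By the Loewner--Heinz inequality
  (\<open>loewner_heinz\<close>) with exponents \<open>t/z\<close> and \<open>z\<close> the map \<open>F\<close> is monotone, and
  \<open>F I = \<Sum>\<^sub>j w\<^sub>j A\<^sub>j\<^bsup>1-t\<^esup> = Q\<^bsup>1-t\<^esup>\<close>, where \<open>Q\<close> is the quasi-arithmetic mean. So \<open>X \<le> I\<close> implies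
  \<open>X = F X \<le> F I = Q\<^bsup>1-t\<^esup>\<close>, and \<open>X \<ge> I\<close> implies the reverse inequality. The near-order contains the
  Loewner order (\<open>near_le_if_loewner_le\<close>) and is preserved by powers with exponent at least \<open>1\<close>
  (\<open>near_le_powr\<close>), an inequality of Ando--Hiai type. The exponent \<open>1 / (1 - t)\<close> then gives both
  claims.

  Since \<open>F\<close> is monotone and homogeneous of degree \<open>t < 1\<close>, it is a strict contraction of the Thompson
  metric on the cone of positive definite operators. This gives the unique fixed point that the
  definition of the Renyi mean refers to (\<open>fixpoint_unique_exists\<close>).

  Powers of operators are given by the continuous functional calculus, which is built up from the
  fact that a symmetric operator on a Hilbert space has norm equal to its spectral radius. Hence
  \<open>\<parallel>p(T)\<parallel> \<le> sup |p|\<close> on the spectrum for real polynomials \<open>p\<close> (\<open>norm_op_poly_le\<close>), so Weierstrass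
  approximation extends \<open>p \<mapsto> p(T)\<close> to continuous functions. The Loewner--Heinz inequality is proved
  by interpolation between the trivial exponents \<open>0\<close> and \<open>1\<close>. For the Ando--Hiai step the
  near-order is rewritten without geometric means: \<open>A \<preceq>\<^sub>N B\<close> holds iff \<open>A \<le> (A\<^bsup>1/2\<^esup> B A\<^bsup>1/2\<^esup>)\<^bsup>1/2\<^esup>\<close>
  (\<open>near_le_iff\<close>).
\<close>

section \<open>Symmetric operators on a real Hilbert space\<close>

text \<open>
  Symmetry refers to the real inner product. The spectral theory of a symmetric operator uses
  nothing complex; complex linearity is added by \<open>hermitian_op\<close> and is inherited by \<open>f(T)\<close>
  because \<open>f(T)\<close> commutes with everything that \<open>T\<close> commutes with.
\<close>

definition sym_op :: "'a::real_inner op \<Rightarrow> bool"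
  where "sym_op T \<longleftrightarrow> (\<forall>x y. inner (T x) y = inner x (T y))"

lemma sym_opD: "sym_op T \<Longrightarrow> inner (T x) y = inner x (T y)"
  by (simp add: sym_op_def)

lemma sym_op_id [simp]: "sym_op id_blinfun"
  by (simp add: sym_op_def)

lemma sym_op_0 [simp]: "sym_op 0"
  by (simp add: sym_op_def)

lemma sym_op_add: "sym_op S \<Longrightarrow> sym_op T \<Longrightarrow> sym_op (S + T)"
  by (simp add: sym_op_def blinfun.bilinear_simps inner_simps)

lemma sym_op_diff: "sym_op S \<Longrightarrow> sym_op T \<Longrightarrow> sym_op (S - T)"
  by (simp add: sym_op_def blinfun.bilinear_simps inner_simps)

lemma sym_op_scaleR: "sym_op T \<Longrightarrow> sym_op (c *\<^sub>R T)"
  by (simp add: sym_op_def blinfun.bilinear_simps)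

lemma sym_op_sandwich: "sym_op C \<Longrightarrow> sym_op T \<Longrightarrow> sym_op (C o\<^sub>L T o\<^sub>L C)"
  by (simp add: sym_op_def)

lemma sym_op_limit:
  assumes "\<And>k. sym_op (T k)" and "T \<longlonglongrightarrow> (S::'a::real_inner op)"
  shows "sym_op S"
  unfolding sym_op_def
proof (intro allI)
  fix x y
  have "(\<lambda>k. inner (T k x) y) \<longlonglongrightarrow> inner (S x) y"
    by (intro tendsto_intros assms(2))
  moreover have "(\<lambda>k. inner (T k x) y) \<longlonglongrightarrow> inner x (S y)"
    unfolding sym_opD[OF assms(1)] by (intro tendsto_intros assms(2))
  ultimately show "inner (S x) y = inner x (S y)"
    by (rule LIMSEQ_unique)
qed

lemma blinfun_compose_assoc: "(f o\<^sub>L g) o\<^sub>L h = f o\<^sub>L (g o\<^sub>L h)"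
  by (rule blinfun_eqI) simp

lemma blinfun_compose_id [simp]: "f o\<^sub>L id_blinfun = f" "id_blinfun o\<^sub>L f = f"
  by (auto intro: blinfun_eqI)

lemmas blinfun_compose_simps =
  bounded_bilinear.add_left[OF bounded_bilinear_blinfun_compose]
  bounded_bilinear.add_right[OF bounded_bilinear_blinfun_compose]
  bounded_bilinear.diff_left[OF bounded_bilinear_blinfun_compose]
  bounded_bilinear.diff_right[OF bounded_bilinear_blinfun_compose]
  bounded_bilinear.scaleR_left[OF bounded_bilinear_blinfun_compose]
  bounded_bilinear.scaleR_right[OF bounded_bilinear_blinfun_compose]

lemma op_inv_eqI:
  assumes "T o\<^sub>L S = id_blinfun" "S o\<^sub>L T = id_blinfun"
  shows "op_inv T = S"
  unfolding op_inv_def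
proof (rule the_equality)
  show "is_op_inverse T S" using assms by (simp add: is_op_inverse_def)
next
  fix S' assume "is_op_inverse T S'"
  then have "S' o\<^sub>L (T o\<^sub>L S) = S"
    by (simp add: is_op_inverse_def flip: blinfun_compose_assoc)
  then show "S' = S" using assms by simp
qed

lemma invertible_op_compose:
  assumes "invertible_op S" "invertible_op T"
  shows "invertible_op (S o\<^sub>L T)"
proof -
  obtain S' T' where "is_op_inverse S S'" "is_op_inverse T T'"
    using assms unfolding invertible_op_def by blast
  then have inv: "S (S' x) = x" "S' (S x) = x" "T (T' x) = x" "T' (T x) = x" for x
    unfolding is_op_inverse_def
    by (metis blinfun_apply_blinfun_compose blinfun_apply_id_blinfun)+
  have "is_op_inverse (S o\<^sub>L T) (T' o\<^sub>L S')"
    unfolding is_op_inverse_def by (auto intro!: blinfun_eqI simp: inv)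
  then show ?thesis unfolding invertible_op_def by blast
qed

lemma invertible_op_scaleR:
  assumes "c \<noteq> 0" "invertible_op T"
  shows "invertible_op (c *\<^sub>R T)"
proof -
  obtain S where "is_op_inverse T S"
    using assms unfolding invertible_op_def by blast
  then have "is_op_inverse (c *\<^sub>R T) ((1/c) *\<^sub>R S)"
    using assms(1) by (simp add: is_op_inverse_def blinfun_compose_simps)
  then show ?thesis unfolding invertible_op_def by blast
qed

lemma invertible_op_bounded_below:
  fixes T :: "'a::real_normed_vector op"
  assumes "invertible_op T"
  obtains c where "0 < c" "\<And>x. c * norm x \<le> norm (T x)"
proof -
  obtain S where "is_op_inverse T S"
    using assms unfolding invertible_op_def by blast
  then have inv: "S (T x) = x" for x
    unfolding is_op_inverse_def
    by (metis blinfun_apply_blinfun_compose blinfun_apply_id_blinfun)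
  have "1 / (norm S + 1) * norm x \<le> norm (T x)" for x
  proof -
    have "norm x \<le> norm S * norm (T x)"
      using norm_blinfun[of S "T x"] inv by simp
    also have "\<dots> \<le> (norm S + 1) * norm (T x)"
      by (simp add: algebra_simps)
    finally show ?thesis
      using norm_ge_zero[of S] by (simp add: field_simps del: norm_ge_zero)
  qed
  moreover have "0 < 1 / (norm S + 1)"
    by (simp add: add_nonneg_pos)
  ultimately show thesis using that by blast
qed

lemma invertible_opI_bounded_below_surj:
  fixes T :: "'a::real_normed_vector op"
  assumes "0 < c" and below: "\<And>x. c * norm x \<le> norm (T x)"
    and surj: "\<And>y. \<exists>x. T x = y"
  shows "invertible_op T"
proof -
  obtain g where g: "T (g y) = y" for y
    using surj by metis
  have inj: "x = x'" if "T x = T x'" for x x'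
    using below[of "x - x'"] that \<open>0 < c\<close>
    by (simp add: blinfun.bilinear_simps mult_le_0_iff)
  have "bounded_linear g"
  proof (rule bounded_linear_intro[where K = "1/c"])
    fix x y r
    show "g (x + y) = g x + g y"
      by (rule inj) (simp add: blinfun.bilinear_simps g)
    show "g (r *\<^sub>R x) = r *\<^sub>R g x"
      by (rule inj) (simp add: blinfun.bilinear_simps g)
    show "norm (g x) \<le> norm x * (1/c)"
      using below[of "g x"] \<open>0 < c\<close> by (simp add: g field_simps)
  qed
  then have G: "blinfun_apply (Blinfun g) = g" by (rule bounded_linear_Blinfun_apply)
  have "g (T x) = x" for x by (rule inj) (simp add: g)
  then have "is_op_inverse T (Blinfun g)"
    unfolding is_op_inverse_def by (auto intro!: blinfun_eqI simp: G g)
  then show ?thesis unfolding invertible_op_def by blast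
qed

text \<open>
  Solving \<open>T x = y\<close> means finding a fixed point of \<open>x \<mapsto> x - \<tau> (T x - y)\<close>. Since
  \<open>\<parallel>x - \<tau> T x\<parallel>\<^sup>2 \<le> (1 - 2 \<tau> c + \<tau>\<^sup>2 K\<^sup>2) \<parallel>x\<parallel>\<^sup>2\<close> for \<open>K \<ge> \<parallel>T\<parallel>\<close>, this map is a contraction for
  \<open>\<tau> = c / K\<^sup>2\<close>, the minimiser of the right-hand side.
\<close>

lemma coercive_op_invertible:
  fixes T :: "'a::{real_inner,complete_space} op"
  assumes "0 < c" and coercive: "\<And>x. c * (norm x)\<^sup>2 \<le> inner x (T x)"
  shows "invertible_op T"
proof (rule invertible_opI_bounded_below_surj[OF \<open>0 < c\<close>])
  show "c * norm x \<le> norm (T x)" for x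
  proof (cases "x = 0")
    case False
    have "c * norm x * norm x \<le> norm (T x) * norm x"
      using coercive[of x] norm_cauchy_schwarz[of x "T x"]
      by (simp add: power2_eq_square mult.commute mult.left_commute)
    then show ?thesis using False by simp
  qed simp
next
  fix y
  \<comment> \<open>The summand \<open>c\<close> makes \<open>K\<close> positive and at least \<open>c\<close> even on the zero space, where
    \<open>norm T\<close> is \<open>0\<close>.\<close>
  define K where "K = norm T + c"
  define \<tau> where "\<tau> = c / K\<^sup>2"
  define q where "q = sqrt (1 - (c/K)\<^sup>2)"
  have K: "0 < K" "c \<le> K" using \<open>0 < c\<close> by (simp_all add: K_def add_nonneg_pos)
  have cK: "0 < c/K" "c/K \<le> 1" using K \<open>0 < c\<close> by auto
  have q: "0 \<le> q" "q < 1"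
    using cK using K by (auto simp: q_def power_le_one)
  have contr: "norm (x - \<tau> *\<^sub>R T x) \<le> q * norm x" for x
  proof -
    have "norm (T x) \<le> norm T * norm x" by (rule norm_blinfun)
    also have "\<dots> \<le> K * norm x"
      using \<open>0 < c\<close> by (simp add: K_def mult_right_mono)
    finally have Tx: "(norm (T x))\<^sup>2 \<le> K\<^sup>2 * (norm x)\<^sup>2"
      by (metis norm_ge_zero power_mono power_mult_distrib)
    have \<tau>: "0 \<le> \<tau>" using \<open>0 < c\<close> by (simp add: \<tau>_def)
    have "(norm (x - \<tau> *\<^sub>R T x))\<^sup>2 = (norm x)\<^sup>2 - 2 * \<tau> * inner x (T x) + \<tau>\<^sup>2 * (norm (T x))\<^sup>2"
      by (simp only: power2_norm_eq_inner)
        (simp add: inner_simps inner_commute power2_eq_square algebra_simps)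
    also have "\<dots> \<le> (norm x)\<^sup>2 - 2 * \<tau> * (c * (norm x)\<^sup>2) + \<tau>\<^sup>2 * (K\<^sup>2 * (norm x)\<^sup>2)"
    proof -
      have "2 * \<tau> * (c * (norm x)\<^sup>2) \<le> 2 * \<tau> * inner x (T x)"
        using coercive[of x] \<tau> by (intro mult_left_mono) auto
      moreover have "\<tau>\<^sup>2 * (norm (T x))\<^sup>2 \<le> \<tau>\<^sup>2 * (K\<^sup>2 * (norm x)\<^sup>2)"
        using Tx by (intro mult_left_mono) auto
      ultimately show ?thesis by linarith
    qed
    also have "\<dots> = (1 - (c/K)\<^sup>2) * (norm x)\<^sup>2"
      using K by (simp add: \<tau>_def field_simps power2_eq_square)
    also have "\<dots> = (q * norm x)\<^sup>2"
      using cK by (simp add: q_def power_mult_distrib power_le_one)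
    finally show ?thesis
      by (rule power2_le_imp_le) (use q in simp)
  qed
  have "\<exists>!x. x - \<tau> *\<^sub>R (T x - y) = x"
  proof (rule banach_fix_type[OF q], intro allI)
    fix x x'
    have "x - \<tau> *\<^sub>R (T x - y) - (x' - \<tau> *\<^sub>R (T x' - y)) = (x - x') - \<tau> *\<^sub>R T (x - x')"
      by (simp add: blinfun.bilinear_simps algebra_simps)
    then show "dist (x - \<tau> *\<^sub>R (T x - y)) (x' - \<tau> *\<^sub>R (T x' - y)) \<le> q * dist x x'"
      using contr[of "x - x'"] by (simp only: dist_norm)
  qed
  then obtain x where "x - \<tau> *\<^sub>R (T x - y) = x" by blast
  then have "\<tau> *\<^sub>R (T x - y) = 0" by (metis diff_eq_eq add_cancel_right_right)
  moreover have "\<tau> \<noteq> 0" using \<open>0 < c\<close> K by (simp add: \<tau>_def)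
  ultimately show "\<exists>x. T x = y" by (metis scaleR_eq_0_iff right_minus_eq)
qed

text \<open>
  Here \<open>T\<^sup>2\<close> is coercive because \<open>\<langle>x, T\<^sup>2 x\<rangle> = \<parallel>T x\<parallel>\<^sup>2\<close>, and a right inverse \<open>S\<close> of \<open>T\<^sup>2\<close>
  gives the right inverse \<open>T S\<close> of \<open>T\<close>.
\<close>

lemma sym_op_invertible_if_bounded_below:
  fixes T :: "'a::{real_inner,complete_space} op"
  assumes "sym_op T" "0 < c" and below: "\<And>x. c * norm x \<le> norm (T x)"
  shows "invertible_op T"
proof -
  have "invertible_op (T o\<^sub>L T)"
  proof (rule coercive_op_invertible)
    show "0 < c\<^sup>2" using \<open>0 < c\<close> by simp
    fix x
    have "c\<^sup>2 * (norm x)\<^sup>2 \<le> (norm (T x))\<^sup>2"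
      using power_mono[OF below[of x], of 2] \<open>0 < c\<close> by (simp add: power_mult_distrib)
    also have "\<dots> = inner x ((T o\<^sub>L T) x)"
      using sym_opD[OF \<open>sym_op T\<close>, of x "T x"] by (simp add: power2_norm_eq_inner)
    finally show "c\<^sup>2 * (norm x)\<^sup>2 \<le> inner x ((T o\<^sub>L T) x)" .
  qed
  then obtain S where "(T o\<^sub>L T) o\<^sub>L S = id_blinfun"
    unfolding invertible_op_def is_op_inverse_def by blast
  then have "T (T (S y)) = y" for y
    by (metis blinfun_apply_blinfun_compose blinfun_apply_id_blinfun)
  then have "\<exists>x. T x = y" for y by blast
  then show ?thesis
    by (rule invertible_opI_bounded_below_surj[OF \<open>0 < c\<close> below])
qed

lemma sym_op_shift: "sym_op T \<Longrightarrow> sym_op (T - r *\<^sub>R id_blinfun)"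
  by (intro sym_op_diff sym_op_scaleR sym_op_id)

lemma op_spectrum_bounded:
  fixes T :: "'a::{real_inner,complete_space} op"
  assumes "sym_op T" "r \<in> op_spectrum T"
  shows "\<bar>r\<bar> \<le> norm T"
proof (rule ccontr)
  assume less: "\<not> \<bar>r\<bar> \<le> norm T"
  have "invertible_op (T - r *\<^sub>R id_blinfun)"
  proof (rule sym_op_invertible_if_bounded_below[OF sym_op_shift[OF assms(1)]])
    show "0 < \<bar>r\<bar> - norm T" using less by simp
    fix x
    have "norm (r *\<^sub>R x) - norm (T x) \<le> norm (T x - r *\<^sub>R x)"
      using norm_triangle_ineq2[of "r *\<^sub>R x" "T x"] by (simp only: norm_minus_commute)
    then show "(\<bar>r\<bar> - norm T) * norm x \<le> norm ((T - r *\<^sub>R id_blinfun) x)"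
      using norm_blinfun[of T x] by (simp add: blinfun.bilinear_simps algebra_simps)
  qed
  then show False using assms(2) by (simp add: op_spectrum_def)
qed

lemma compact_op_spectrum:
  fixes T :: "'a::{real_inner,complete_space} op"
  assumes "sym_op T"
  shows "compact (op_spectrum T)"
proof -
  have "open (- op_spectrum T)"
    unfolding open_dist
  proof (intro ballI)
    fix r assume "r \<in> - op_spectrum T"
    then have "invertible_op (T - r *\<^sub>R id_blinfun)" by (simp add: op_spectrum_def)
    then obtain c where c: "0 < c" "\<And>x. c * norm x \<le> norm ((T - r *\<^sub>R id_blinfun) x)"
      using invertible_op_bounded_below by blast
    have "s \<in> - op_spectrum T" if "dist s r < c" for s
    proof -
      have "invertible_op (T - s *\<^sub>R id_blinfun)"
      proof (rule sym_op_invertible_if_bounded_below[OF sym_op_shift[OF assms]])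
        show "0 < c - \<bar>s - r\<bar>" using that by (simp add: dist_real_def)
        fix x
        have "(T - r *\<^sub>R id_blinfun) x = (T - s *\<^sub>R id_blinfun) x + (s - r) *\<^sub>R x"
          by (simp add: blinfun.bilinear_simps algebra_simps)
        then have "norm ((T - r *\<^sub>R id_blinfun) x)
            \<le> norm ((T - s *\<^sub>R id_blinfun) x) + \<bar>s - r\<bar> * norm x"
          by (metis norm_scaleR norm_triangle_ineq)
        then show "(c - \<bar>s - r\<bar>) * norm x \<le> norm ((T - s *\<^sub>R id_blinfun) x)"
          using c(2)[of x] by (simp add: left_diff_distrib)
      qed
      then show ?thesis by (simp add: op_spectrum_def)
    qed
    then show "\<exists>e>0. \<forall>s. dist s r < e \<longrightarrow> s \<in> - op_spectrum T"
      using c(1) by blast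
  qed
  moreover have "bounded (op_spectrum T)"
    unfolding bounded_iff using op_spectrum_bounded[OF assms] by auto
  ultimately show ?thesis
    by (simp add: compact_eq_bounded_closed closed_def)
qed

text \<open>
  The norm of a symmetric operator is its spectral radius. Put \<open>m = \<parallel>T\<parallel>\<close>. If neither \<open>m\<close> nor
  \<open>-m\<close> is in the spectrum, then \<open>T\<^sup>2 - m\<^sup>2\<close> is bounded below by some \<open>d > 0\<close>, while
  \<open>\<parallel>(T\<^sup>2 - m\<^sup>2) x\<parallel>\<^sup>2 \<le> m\<^sup>2 (m\<^sup>2 \<parallel>x\<parallel>\<^sup>2 - \<parallel>T x\<parallel>\<^sup>2)\<close>. Together these bound \<open>\<parallel>T\<parallel>\<close> by a number
  below \<open>m\<close>.
\<close>

lemma norm_sym_op_le_if_spectrum_le: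
  fixes T :: "'a::{real_inner,complete_space} op"
  assumes "sym_op T" "0 \<le> c" and spec: "\<And>r. r \<in> op_spectrum T \<Longrightarrow> \<bar>r\<bar> \<le> c"
  shows "norm T \<le> c"
proof (rule ccontr)
  assume "\<not> norm T \<le> c"
  define m where "m = norm T"
  have m: "c < m" "0 < m" using \<open>\<not> norm T \<le> c\<close> \<open>0 \<le> c\<close> by (auto simp: m_def)
  have "m \<notin> op_spectrum T" "- m \<notin> op_spectrum T"
    using spec m by force+
  then have "invertible_op ((T - m *\<^sub>R id_blinfun) o\<^sub>L (T - (-m) *\<^sub>R id_blinfun))"
    by (intro invertible_op_compose) (simp_all add: op_spectrum_def)
  then obtain d where d: "0 < d"
    "\<And>x. d * norm x \<le> norm (((T - m *\<^sub>R id_blinfun) o\<^sub>L (T - (-m) *\<^sub>R id_blinfun)) x)"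
    using invertible_op_bounded_below by blast
  \<comment> \<open>The maximum covers the zero space, where the difference can be negative.\<close>
  define q where "q = sqrt (max 0 (m\<^sup>2 - d\<^sup>2 / m\<^sup>2))"
  have "norm (T x) \<le> q * norm x" for x
  proof -
    have "(d * norm x)\<^sup>2 \<le> (norm (T (T x) - m\<^sup>2 *\<^sub>R x))\<^sup>2"
      using d by (intro power_mono) (auto simp: blinfun.bilinear_simps power2_eq_square algebra_simps)
    also have "\<dots> = (norm (T (T x)))\<^sup>2 - 2 * m\<^sup>2 * inner (T (T x)) x + m^4 * (norm x)\<^sup>2"
      by (simp only: power2_norm_eq_inner)
        (simp add: inner_simps inner_commute power2_eq_square power4_eq_xxxx algebra_simps)
    also have "inner (T (T x)) x = (norm (T x))\<^sup>2"
      by (simp add: power2_norm_eq_inner sym_opD[OF assms(1)])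
    also have "(norm (T (T x)))\<^sup>2 \<le> m\<^sup>2 * (norm (T x))\<^sup>2"
      unfolding m_def by (metis norm_blinfun norm_ge_zero power_mono power_mult_distrib)
    finally have "d\<^sup>2 * (norm x)\<^sup>2 \<le> m^4 * (norm x)\<^sup>2 - m\<^sup>2 * (norm (T x))\<^sup>2"
      by (simp add: power_mult_distrib)
    then have "(norm (T x))\<^sup>2 \<le> (m\<^sup>2 - d\<^sup>2 / m\<^sup>2) * (norm x)\<^sup>2"
      using m by (simp add: field_simps power2_eq_square power4_eq_xxxx)
    also have "\<dots> \<le> (q * norm x)\<^sup>2"
      by (simp add: q_def power_mult_distrib mult_right_mono)
    finally show ?thesis
      by (rule power2_le_imp_le) (simp add: q_def)
  qed
  then have "m \<le> q"
    unfolding m_def by (intro norm_blinfun_bound) (auto simp: q_def)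
  moreover have "q < m"
    unfolding q_def using m d by (intro real_less_lsqrt) auto
  ultimately show False by simp
qed

section \<open>Polynomials in a symmetric operator\<close>

lemma op_power_0 [simp]: "op_power T 0 = id_blinfun"
  and op_power_Suc [simp]: "op_power T (Suc k) = T o\<^sub>L op_power T k"
  by (simp_all add: op_power_def)

text \<open>
  A common upper summation limit makes sums of polynomials of different degrees comparable.
\<close>

lemma op_poly_eq_sum:
  assumes "degree p \<le> n"
  shows "op_poly p T = (\<Sum>i\<le>n. coeff p i *\<^sub>R op_power T i)"
  unfolding op_poly_def
  by (rule sum.mono_neutral_left) (use assms in \<open>auto intro: coeff_eq_0\<close>)

lemma op_poly_0 [simp]: "op_poly 0 T = 0"
  by (simp add: op_poly_def)

lemma op_poly_add: "op_poly (p + q) T = op_poly p T + op_poly q T"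
proof -
  define n where "n = max (degree p) (degree q)"
  have "degree (p + q) \<le> n" "degree p \<le> n" "degree q \<le> n"
    by (auto simp: n_def degree_add_le)
  then show ?thesis
    by (simp add: op_poly_eq_sum[of _ n] sum.distrib algebra_simps)
qed

lemma op_poly_pCons: "op_poly (pCons a p) T = a *\<^sub>R id_blinfun + (T o\<^sub>L op_poly p T)"
proof -
  have "op_poly (pCons a p) T =
      (\<Sum>i\<le>Suc (degree p). coeff (pCons a p) i *\<^sub>R op_power T i)"
    by (rule op_poly_eq_sum) (simp add: degree_pCons_le)
  also have "\<dots> = a *\<^sub>R id_blinfun + (T o\<^sub>L op_poly p T)"
    by (simp add: sum.atMost_Suc_shift op_poly_def blinfun_compose_simps
        bounded_bilinear.sum_right[OF bounded_bilinear_blinfun_compose]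
        del: sum.atMost_Suc)
  finally show ?thesis .
qed

lemma op_poly_smult: "op_poly (smult c p) T = c *\<^sub>R op_poly p T"
  by (induction p) (simp_all add: op_poly_pCons blinfun_compose_simps algebra_simps)

lemma op_poly_diff: "op_poly (p - q) T = op_poly p T - op_poly q T"
  using op_poly_add[of p "smult (-1) q" T] by (simp only: op_poly_smult) simp

lemma op_poly_mult: "op_poly (p * q) T = op_poly p T o\<^sub>L op_poly q T"
  by (induction p)
    (simp_all add: op_poly_pCons op_poly_add op_poly_smult blinfun_compose_simps blinfun_compose_assoc)

lemma op_poly_intertwine:
  assumes "S o\<^sub>L Z = Z o\<^sub>L T"
  shows "op_poly p S o\<^sub>L Z = Z o\<^sub>L op_poly p T"
proof (induction p)
  case (pCons a p)
  have "S o\<^sub>L op_poly p S o\<^sub>L Z = Z o\<^sub>L T o\<^sub>L op_poly p T"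
    by (simp add: blinfun_compose_assoc pCons.IH flip: assms)
  then show ?case
    by (simp add: op_poly_pCons blinfun_compose_simps blinfun_compose_assoc)
qed simp

lemma sym_op_poly:
  assumes "sym_op T"
  shows "sym_op (op_poly p T)"
proof (induction p)
  case (pCons a p)
  have "op_poly p T o\<^sub>L T = T o\<^sub>L op_poly p T"
    by (rule op_poly_intertwine) simp
  then have "op_poly p T (T x) = T (op_poly p T x)" for x
    by (metis blinfun_apply_blinfun_compose)
  then have "sym_op (T o\<^sub>L op_poly p T)"
    using sym_opD[OF assms] sym_opD[OF pCons.IH] by (simp add: sym_op_def)
  then show ?case
    by (simp add: op_poly_pCons sym_op_add sym_op_scaleR)
qed simp

lemma invertible_op_id: "invertible_op id_blinfun"
  unfolding invertible_op_def is_op_inverse_def by (metis blinfun_compose_id(1))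

text \<open>
  The operator is \<open>(T - a)\<^sup>2 + b\<^sup>2\<close>, hence coercive with constant \<open>b\<^sup>2\<close>.
\<close>

lemma invertible_op_quadratic:
  fixes T :: "'a::{real_inner,complete_space} op"
  assumes "sym_op T" "b \<noteq> 0"
  shows "invertible_op (op_poly [:a\<^sup>2 + b\<^sup>2, - 2 * a, 1:] T)"
proof (rule coercive_op_invertible)
  show "0 < b\<^sup>2" using assms(2) by simp
  fix x
  have "inner x (op_poly [:a\<^sup>2 + b\<^sup>2, - 2 * a, 1:] T x)
      = (norm (T x - a *\<^sub>R x))\<^sup>2 + b\<^sup>2 * (norm x)\<^sup>2"
    unfolding power2_norm_eq_inner
    using sym_opD[OF assms(1), of x "T x"] sym_opD[OF assms(1), of x x]
    by (simp add: op_poly_pCons blinfun.bilinear_simps inner_simps power2_eq_square algebra_simps)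
  then show "b\<^sup>2 * (norm x)\<^sup>2 \<le> inner x (op_poly [:a\<^sup>2 + b\<^sup>2, - 2 * a, 1:] T x)"
    by simp
qed

text \<open>
  By the fundamental theorem of algebra \<open>p\<close> has a complex root \<open>z\<close>. A real \<open>z\<close> splits off a
  linear factor. Otherwise divide by the real quadratic with roots \<open>z\<close> and its conjugate: the
  remainder is real, of degree at most one, and vanishes at the non-real \<open>z\<close>, so it is zero.
\<close>

lemma real_poly_factor_cases:
  fixes p :: "real poly"
  assumes "degree p \<noteq> 0"
  obtains r q where "p = [:- r, 1:] * q"
  | a b q where "b \<noteq> 0" "p = [:a\<^sup>2 + b\<^sup>2, - 2 * a, 1:] * q"
proof -
  define C where "C = map_poly complex_of_real"
  have C_pCons: "C (pCons a p) = pCons (of_real a) (C p)" for a p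
    by (simp add: C_def map_poly_pCons)
  have C_0: "C 0 = 0" by (simp add: C_def)
  have C_add: "C (p + q) = C p + C q" for p q
    by (rule poly_eqI) (simp add: C_def coeff_map_poly)
  have C_mult: "C (p * q) = C p * C q" for p q
  proof (induction p)
    case (pCons a p)
    have "C (smult a q) = smult (of_real a) (C q)"
      by (rule poly_eqI) (simp add: C_def coeff_map_poly)
    then show ?case using pCons.IH by (simp add: C_add C_pCons)
  qed (simp add: C_0)
  have "degree (C p) = degree p" by (simp add: C_def degree_map_poly)
  then have "\<not> constant (poly (C p))" using assms by (simp add: constant_degree)
  then obtain z where z: "poly (C p) z = 0"
    using fundamental_theorem_of_algebra by blast
  show thesis
  proof (cases "Im z = 0")
    case True
    then have "z = of_real (Re z)" by (simp add: complex_eq_iff)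
    moreover have "poly (C p) (of_real r) = of_real (poly p r)" for r
      by (induction p) (simp_all add: C_pCons C_0)
    ultimately have "poly p (Re z) = 0" using z by (metis of_real_eq_0_iff)
    then show thesis using that(1) by (metis dvd_def poly_eq_0_iff_dvd)
  next
    case False
    define d where "d = [:(Re z)\<^sup>2 + (Im z)\<^sup>2, - 2 * Re z, 1:]"
    obtain u v where uv: "p mod d = [:u, v:]"
    proof -
      have "degree (p mod d) \<le> 1"
        using degree_mod_less[of d p] by (auto simp: d_def)
      then have "p mod d = [:coeff (p mod d) 0, coeff (p mod d) 1:]"
        by (intro poly_eqI) (auto simp: coeff_pCons coeff_eq_0 split: nat.split)
      then show thesis using that by blast
    qed
    have "poly (C d) z = 0"
      by (simp add: d_def C_pCons C_0 complex_eq_iff power2_eq_square algebra_simps)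
    moreover have "poly (C p) z = poly (C (p div d)) z * poly (C d) z + poly (C (p mod d)) z"
      by (metis C_add C_mult div_mult_mod_eq poly_add poly_mult)
    ultimately have "poly (C [:u, v:]) z = 0" using z uv by simp
    then have "v = 0" "u = 0"
      using False by (auto simp: C_pCons C_0 complex_eq_iff)
    then have "p = d * (p div d)" using uv by (metis add.right_neutral mult.commute div_mult_mod_eq pCons_0_0)
    then show thesis using that(2)[OF False] by (simp add: d_def)
  qed
qed

text \<open>
  Real factors of \<open>p\<close> are split off one at a time: a linear factor is invertible at \<open>T\<close> because
  its root is a root of \<open>p\<close> and so lies outside the spectrum, an irreducible quadratic factor is
  always invertible at \<open>T\<close>.
\<close>

lemma op_poly_invertible:
  fixes T :: "'a::{real_inner,complete_space} op"
  assumes "sym_op T" "p \<noteq> 0" "\<And>r. r \<in> op_spectrum T \<Longrightarrow> poly p r \<noteq> 0"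
  shows "invertible_op (op_poly p T)"
  using assms(2,3)
proof (induction "degree p" arbitrary: p rule: less_induct)
  case less
  show ?case
  proof (cases "degree p = 0")
    case True
    then obtain c where "p = [:c:]" by (rule degree_eq_zeroE)
    then show ?thesis
      using less.prems by (simp add: op_poly_pCons invertible_op_scaleR invertible_op_id)
  next
    case False
    have IH: "invertible_op (op_poly q T)" if "p = d * q" "degree d \<noteq> 0" for d q
    proof (rule less.hyps)
      have "d \<noteq> 0" "q \<noteq> 0" using that less.prems by auto
      then show "q \<noteq> 0" "degree q < degree p" using that by (auto simp: degree_mult_eq)
    qed (use that less.prems in auto)
    from False show ?thesis
    proof (cases rule: real_poly_factor_cases)
      case (1 r q)
      have "poly p r = 0" by (simp add: 1)
      then have "invertible_op (op_poly [:- r, 1:] T)"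
        using less.prems(2)[of r] by (auto simp: op_spectrum_def op_poly_pCons add.commute)
      then show ?thesis
        using IH[OF 1] unfolding 1 op_poly_mult by (intro invertible_op_compose) auto
    next
      case (2 a b q)
      then show ?thesis
        using IH[OF 2(2)] invertible_op_quadratic[OF assms(1) 2(1), of a]
        unfolding 2(2) op_poly_mult by (intro invertible_op_compose) auto
    qed
  qed
qed

text \<open>
  Only on the zero space is the spectrum empty; there all operators are equal.
\<close>

lemma op_spectrum_empty_imp:
  fixes T S :: "'a::{real_inner,complete_space} op"
  assumes "sym_op T" "op_spectrum T = {}"
  shows "S = 0"
proof -
  have "norm T \<le> 0"
    by (rule norm_sym_op_le_if_spectrum_le[OF assms(1)]) (simp_all add: assms(2))
  then have "invertible_op (0 :: 'a op)"
    using assms(2) by (auto simp: op_spectrum_def dest: spec[of _ 0])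
  then have "(id_blinfun :: 'a op) = 0"
    by (auto simp: invertible_op_def is_op_inverse_def)
  then have "S o\<^sub>L id_blinfun = 0" by simp
  then show ?thesis by simp
qed

text \<open>
  Half of the spectral mapping theorem: if \<open>p - l\<close> has no zero on the spectrum of \<open>T\<close>, then
  \<open>p(T) - l\<close> is invertible. The constant polynomial \<open>p = l\<close> is a separate case, as \<open>p - l = 0\<close>
  carries no information.
\<close>

lemma op_spectrum_op_poly:
  fixes T :: "'a::{real_inner,complete_space} op"
  assumes "sym_op T"
  shows "op_spectrum (op_poly p T) \<subseteq> poly p ` op_spectrum T"
proof (cases "op_spectrum T = {}")
  case True
  then have *: "R = S" for R S :: "'a op"
    using op_spectrum_empty_imp[OF assms] by metis
  show ?thesis
    using *[of _ id_blinfun] invertible_op_id unfolding op_spectrum_def by (metis (mono_tags, lifting) mem_Collect_eq subsetI)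
next
  case False
  show ?thesis
  proof
    fix l assume "l \<in> op_spectrum (op_poly p T)"
    then have l: "\<not> invertible_op (op_poly (p - [:l:]) T)"
      by (simp add: op_spectrum_def op_poly_diff op_poly_pCons)
    show "l \<in> poly p ` op_spectrum T"
    proof (cases "p = [:l:]")
      case True
      then show ?thesis using False by auto
    next
      assume "p \<noteq> [:l:]"
      then obtain r where "r \<in> op_spectrum T" "poly (p - [:l:]) r = 0"
        using l op_poly_invertible[OF assms, of "p - [:l:]"] by auto
      then show ?thesis by force
    qed
  qed
qed

text \<open>
  This estimate turns uniform convergence of polynomials on the spectrum into norm convergence
  of operators; the whole functional calculus rests on it.
\<close>

lemma norm_op_poly_le:
  fixes T :: "'a::{real_inner,complete_space} op"
  assumes "sym_op T" "0 \<le> c" "\<And>r. r \<in> op_spectrum T \<Longrightarrow> \<bar>poly p r\<bar> \<le> c"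
  shows "norm (op_poly p T) \<le> c"
  by (rule norm_sym_op_le_if_spectrum_le[OF sym_op_poly[OF assms(1)] assms(2)])
    (use op_spectrum_op_poly[OF assms(1), of p] assms(3) in auto)

section \<open>The continuous functional calculus\<close>

lemma uniform_limit_polynomials:
  fixes f :: "real \<Rightarrow> real"
  assumes "compact K" "continuous_on K f"
  obtains p :: "nat \<Rightarrow> real poly" where "uniform_limit K (\<lambda>k x. poly (p k) x) f sequentially"
proof -
  have "\<exists>q. \<forall>x\<in>K. \<bar>f x - poly q x\<bar> < e" if "0 < e" for e
  proof -
    obtain g where "real_polynomial_function g" and g: "\<And>x. x \<in> K \<Longrightarrow> \<bar>f x - g x\<bar> < e"
      using Stone_Weierstrass_real_polynomial_function[OF assms \<open>0 < e\<close>] by blast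
    then obtain a n where "g = (\<lambda>x. \<Sum>i\<le>n. a i * x ^ i)"
      using real_polynomial_function_iff_sum by blast
    then have "poly (\<Sum>i\<le>n. monom (a i) i) x = g x" for x
      by (simp add: poly_sum poly_monom)
    then show ?thesis using g by metis
  qed
  then have "\<exists>q. \<forall>x\<in>K. \<bar>f x - poly q x\<bar> < 1 / Suc k" for k
    by simp
  then obtain p where p: "\<And>k x. x \<in> K \<Longrightarrow> \<bar>f x - poly (p k) x\<bar> < 1 / Suc k"
    by metis
  have "uniform_limit K (\<lambda>k x. poly (p k) x) f sequentially"
  proof (rule uniform_limitI)
    fix e :: real assume "0 < e"
    then have "\<forall>\<^sub>F k in sequentially. 1 / Suc k < e"
      using LIMSEQ_inverse_real_of_nat by (auto simp: inverse_eq_divide dest: order_tendstoD(2))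
    then show "\<forall>\<^sub>F k in sequentially. \<forall>x\<in>K. dist (poly (p k) x) (f x) < e"
    proof eventually_elim
      case (elim k)
      show ?case
      proof
        fix x assume "x \<in> K"
        then show "dist (poly (p k) x) (f x) < e"
          using p[of x k] elim by (simp add: dist_real_def abs_minus_commute)
      qed
    qed
  qed
  then show thesis by (rule that)
qed

text \<open>
  If two sequences of polynomials both converge to \<open>f\<close> uniformly on the spectrum, then the norms of
  their differences at \<open>T\<close> tend to \<open>0\<close>. Taken for one sequence this is the Cauchy property,
  taken for two it says that the limit does not depend on the sequence. So the definite
  description in \<open>op_fun\<close> denotes.
\<close>

lemma tendsto_op_fun:
  fixes T :: "'a::{real_inner,banach} op"
  assumes "sym_op T"
    and p: "uniform_limit (op_spectrum T) (\<lambda>k x. poly (p k) x) f sequentially"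
  shows "(\<lambda>k. op_poly (p k) T) \<longlonglongrightarrow> op_fun f T"
proof -
  have close: "\<exists>N. \<forall>m\<ge>N. \<forall>n\<ge>N. norm (op_poly (q m) T - op_poly (r n) T) < e"
    if q: "uniform_limit (op_spectrum T) (\<lambda>k x. poly (q k) x) f sequentially"
      and r: "uniform_limit (op_spectrum T) (\<lambda>k x. poly (r k) x) f sequentially" and "0 < e"
    for q r :: "nat \<Rightarrow> real poly" and e
  proof -
    have "0 < e/3" using that by simp
    obtain N where N: "\<And>k x. k \<ge> N \<Longrightarrow> x \<in> op_spectrum T \<Longrightarrow> dist (poly (q k) x) (f x) < e/3"
        "\<And>k x. k \<ge> N \<Longrightarrow> x \<in> op_spectrum T \<Longrightarrow> dist (poly (r k) x) (f x) < e/3"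
      using eventually_conj[OF uniform_limitD[OF q \<open>0 < e/3\<close>] uniform_limitD[OF r \<open>0 < e/3\<close>]]
      unfolding eventually_sequentially by blast
    have "norm (op_poly (q m - r n) T) \<le> 2 * (e/3)" if "m \<ge> N" "n \<ge> N" for m n
    proof (rule norm_op_poly_le[OF \<open>sym_op T\<close>])
      fix x assume "x \<in> op_spectrum T"
      then show "\<bar>poly (q m - r n) x\<bar> \<le> 2 * (e/3)"
        using N(1)[OF that(1), of x] N(2)[OF that(2), of x]
        unfolding dist_real_def poly_diff by linarith
    qed (use \<open>0 < e\<close> in simp)
    moreover have "2 * (e/3) < e" using \<open>0 < e\<close> by simp
    ultimately show ?thesis by (metis op_poly_diff order.strict_trans1)
  qed
  have "Cauchy (\<lambda>k. op_poly (p k) T)"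
    using close[OF p p] by (rule CauchyI)
  then obtain S where S: "(\<lambda>k. op_poly (p k) T) \<longlonglongrightarrow> S"
    using Cauchy_convergent convergent_def by metis
  have "(\<lambda>k. op_poly (q k) T) \<longlonglongrightarrow> S"
    if q: "uniform_limit (op_spectrum T) (\<lambda>k x. poly (q k) x) f sequentially" for q
  proof -
    have "(\<lambda>k. op_poly (q k) T - op_poly (p k) T) \<longlonglongrightarrow> 0"
      by (rule LIMSEQ_I) (metis close[OF q p] diff_zero)
    from tendsto_add[OF this S] show ?thesis by simp
  qed
  then have "op_fun f T = S"
    unfolding op_fun_def using p LIMSEQ_unique by (intro the_equality) blast+
  then show ?thesis using S by simp
qed

lemma op_fun_eqI:
  fixes T :: "'a::{real_inner,banach} op"
  assumes "sym_op T"
    and "uniform_limit (op_spectrum T) (\<lambda>k x. poly (p k) x) f sequentially"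
    and "(\<lambda>k. op_poly (p k) T) \<longlonglongrightarrow> S"
  shows "op_fun f T = S"
  using tendsto_op_fun[OF assms(1,2)] assms(3) by (rule LIMSEQ_unique)

lemma op_fun_cong:
  assumes "\<And>x. x \<in> op_spectrum T \<Longrightarrow> f x = g x"
  shows "op_fun f T = op_fun g T"
proof -
  have "uniform_limit (op_spectrum T) (\<lambda>k x. poly (p k) x) f sequentially \<longleftrightarrow>
      uniform_limit (op_spectrum T) (\<lambda>k x. poly (p k) x) g sequentially" for p
    by (rule uniform_limit_cong') (use assms in auto)
  then show ?thesis unfolding op_fun_def by simp
qed

lemma op_fun_poly:
  fixes T :: "'a::{real_inner,banach} op"
  assumes "sym_op T"
  shows "op_fun (poly p) T = op_poly p T"
  by (rule op_fun_eqI[OF assms, where p = "\<lambda>k. p"]) (auto intro: uniform_limit_const)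

lemma op_fun_const:
  fixes T :: "'a::{real_inner,banach} op"
  assumes "sym_op T"
  shows "op_fun (\<lambda>x. c) T = c *\<^sub>R id_blinfun"
  using op_fun_poly[OF assms, of "[:c:]"] by (simp add: op_poly_pCons cong: op_fun_cong)

lemma op_fun_ident:
  fixes T :: "'a::{real_inner,banach} op"
  assumes "sym_op T"
  shows "op_fun (\<lambda>x. x) T = T"
  using op_fun_poly[OF assms, of "[:0, 1:]"]
  by (simp add: op_poly_pCons fun_eq_iff cong: op_fun_cong)

lemma op_fun_add:
  fixes T :: "'a::{real_inner,banach} op"
  assumes T: "sym_op T"
    and f: "continuous_on (op_spectrum T) f" and g: "continuous_on (op_spectrum T) g"
  shows "op_fun (\<lambda>x. f x + g x) T = op_fun f T + op_fun g T"
proof -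
  obtain p q where
    p: "uniform_limit (op_spectrum T) (\<lambda>k x. poly (p k) x) f sequentially" and
    q: "uniform_limit (op_spectrum T) (\<lambda>k x. poly (q k) x) g sequentially"
    using uniform_limit_polynomials[OF compact_op_spectrum[OF T] f]
      uniform_limit_polynomials[OF compact_op_spectrum[OF T] g] by metis
  show ?thesis
  proof (rule op_fun_eqI[OF T])
    show "uniform_limit (op_spectrum T) (\<lambda>k x. poly (p k + q k) x) (\<lambda>x. f x + g x) sequentially"
      using uniform_limit_add[OF p q] by simp
    show "(\<lambda>k. op_poly (p k + q k) T) \<longlonglongrightarrow> op_fun f T + op_fun g T"
      unfolding op_poly_add by (intro tendsto_add tendsto_op_fun T p q)
  qed
qed

lemma op_fun_mult:
  fixes T :: "'a::{real_inner,banach} op"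
  assumes T: "sym_op T"
    and f: "continuous_on (op_spectrum T) f" and g: "continuous_on (op_spectrum T) g"
  shows "op_fun (\<lambda>x. f x * g x) T = op_fun f T o\<^sub>L op_fun g T"
proof -
  note comp = compact_op_spectrum[OF T]
  obtain p q where
    p: "uniform_limit (op_spectrum T) (\<lambda>k x. poly (p k) x) f sequentially" and
    q: "uniform_limit (op_spectrum T) (\<lambda>k x. poly (q k) x) g sequentially"
    using uniform_limit_polynomials[OF comp f] uniform_limit_polynomials[OF comp g] by metis
  have bdd: "bounded (f ` op_spectrum T)" "bounded (g ` op_spectrum T)"
    using f g comp by (auto intro: compact_imp_bounded compact_continuous_image)
  show ?thesis
  proof (rule op_fun_eqI[OF T])
    show "uniform_limit (op_spectrum T) (\<lambda>k x. poly (p k * q k) x) (\<lambda>x. f x * g x) sequentially"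
      using uniform_lim_mult[OF p q bdd] by simp
    show "(\<lambda>k. op_poly (p k * q k) T) \<longlonglongrightarrow> (op_fun f T o\<^sub>L op_fun g T)"
      unfolding op_poly_mult
      by (intro bounded_bilinear.tendsto[OF bounded_bilinear_blinfun_compose] tendsto_op_fun T p q)
  qed
qed

lemma op_fun_diff:
  fixes T :: "'a::{real_inner,banach} op"
  assumes T: "sym_op T"
    and f: "continuous_on (op_spectrum T) f" and g: "continuous_on (op_spectrum T) g"
  shows "op_fun (\<lambda>x. f x - g x) T = op_fun f T - op_fun g T"
proof -
  have "op_fun (\<lambda>x. (f x - g x) + g x) T = op_fun (\<lambda>x. f x - g x) T + op_fun g T"
    by (rule op_fun_add[OF T _ g]) (intro continuous_on_diff f g)
  then show ?thesis by simp
qed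

lemma sym_op_fun:
  fixes T :: "'a::{real_inner,banach} op"
  assumes T: "sym_op T" and f: "continuous_on (op_spectrum T) f"
  shows "sym_op (op_fun f T)"
proof -
  obtain p where "uniform_limit (op_spectrum T) (\<lambda>k x. poly (p k) x) f sequentially"
    using uniform_limit_polynomials[OF compact_op_spectrum[OF T] f] by blast
  then show ?thesis
    by (intro sym_op_limit[OF sym_op_poly[OF T] tendsto_op_fun[OF T]])
qed

text \<open>
  Polynomials satisfy the identity, and one sequence of polynomials approximates \<open>f\<close> on both
  spectra. For \<open>S = T\<close> this says that \<open>f(T)\<close> commutes with all that \<open>T\<close> commutes with; for
  \<open>S = Z Y\<close> and \<open>T = Y Z\<close> it moves \<open>Z\<close> past a function of a product.
\<close>

lemma op_fun_intertwine:
  fixes S T Z :: "'a::{real_inner,banach} op"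
  assumes S: "sym_op S" and T: "sym_op T"
    and f: "continuous_on (op_spectrum S \<union> op_spectrum T) f"
    and Z: "S o\<^sub>L Z = Z o\<^sub>L T"
  shows "op_fun f S o\<^sub>L Z = Z o\<^sub>L op_fun f T"
proof -
  obtain p where p: "uniform_limit (op_spectrum S \<union> op_spectrum T) (\<lambda>k x. poly (p k) x) f sequentially"
    using uniform_limit_polynomials[OF compact_Un[OF compact_op_spectrum[OF S] compact_op_spectrum[OF T]] f]
    by blast
  have "(\<lambda>k. op_poly (p k) S o\<^sub>L Z) \<longlonglongrightarrow> (op_fun f S o\<^sub>L Z)"
    by (intro bounded_bilinear.tendsto[OF bounded_bilinear_blinfun_compose] tendsto_const
        tendsto_op_fun S uniform_limit_on_subset[OF p]) auto
  moreover have "(\<lambda>k. Z o\<^sub>L op_poly (p k) T) \<longlonglongrightarrow> (Z o\<^sub>L op_fun f T)"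
    by (intro bounded_bilinear.tendsto[OF bounded_bilinear_blinfun_compose] tendsto_const
        tendsto_op_fun T uniform_limit_on_subset[OF p]) auto
  ultimately show ?thesis
    unfolding op_poly_intertwine[OF Z] by (rule LIMSEQ_unique)
qed

text \<open>
  For \<open>l\<close> outside the image, \<open>1 / (f - l)\<close> is continuous on the spectrum and its value at \<open>T\<close> is
  the inverse of \<open>f(T) - l\<close>.
\<close>

lemma op_spectrum_op_fun:
  fixes T :: "'a::{real_inner,banach} op"
  assumes T: "sym_op T" and f: "continuous_on (op_spectrum T) f"
  shows "op_spectrum (op_fun f T) \<subseteq> f ` op_spectrum T"
proof
  fix l assume l: "l \<in> op_spectrum (op_fun f T)"
  show "l \<in> f ` op_spectrum T"
  proof (rule ccontr)
    assume "l \<notin> f ` op_spectrum T"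
    then have nz: "f x - l \<noteq> 0" if "x \<in> op_spectrum T" for x using that by auto
    have h: "continuous_on (op_spectrum T) (\<lambda>x. 1 / (f x - l))"
      using nz by (intro continuous_intros f) auto
    have fl: "continuous_on (op_spectrum T) (\<lambda>x. f x - l)"
      by (intro continuous_intros f)
    have "op_fun (\<lambda>x. (f x - l) * (1 / (f x - l))) T = op_fun (\<lambda>x. 1) T"
      "op_fun (\<lambda>x. (1 / (f x - l)) * (f x - l)) T = op_fun (\<lambda>x. 1) T"
      by (rule op_fun_cong; use nz in simp)+
    then have "is_op_inverse (op_fun (\<lambda>x. f x - l) T) (op_fun (\<lambda>x. 1 / (f x - l)) T)"
      unfolding is_op_inverse_def op_fun_mult[OF T fl h] op_fun_mult[OF T h fl] op_fun_const[OF T]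
      by simp
    moreover have "op_fun (\<lambda>x. f x - l) T = op_fun f T - l *\<^sub>R id_blinfun"
      by (simp add: op_fun_diff[OF T f] op_fun_const[OF T])
    ultimately show False
      using l unfolding op_spectrum_def invertible_op_def by auto
  qed
qed

lemma norm_op_fun_le:
  fixes T :: "'a::{real_inner,banach} op"
  assumes T: "sym_op T" and f: "continuous_on (op_spectrum T) f"
    and "0 \<le> c" "\<And>x. x \<in> op_spectrum T \<Longrightarrow> \<bar>f x\<bar> \<le> c"
  shows "norm (op_fun f T) \<le> c"
  by (rule norm_sym_op_le_if_spectrum_le[OF sym_op_fun[OF T f] \<open>0 \<le> c\<close>])
    (use op_spectrum_op_fun[OF T f] assms(4) in auto)

text \<open>
  \<open>f(T)\<close> is the square of the symmetric operator that belongs to the square root of \<open>f\<close>.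
\<close>

lemma op_fun_nonneg:
  fixes T :: "'a::{real_inner,banach} op"
  assumes T: "sym_op T" and f: "continuous_on (op_spectrum T) f"
    and nonneg: "\<And>x. x \<in> op_spectrum T \<Longrightarrow> 0 \<le> f x"
  shows "0 \<le> inner v (op_fun f T v)"
proof -
  have g: "continuous_on (op_spectrum T) (\<lambda>x. sqrt (f x))"
    by (intro continuous_intros f)
  have "op_fun f T = op_fun (\<lambda>x. sqrt (f x) * sqrt (f x)) T"
    by (rule op_fun_cong) (simp add: nonneg)
  also have "\<dots> = op_fun (\<lambda>x. sqrt (f x)) T o\<^sub>L op_fun (\<lambda>x. sqrt (f x)) T"
    by (rule op_fun_mult[OF T g g])
  finally show ?thesis
    using sym_opD[OF sym_op_fun[OF T g], of v "op_fun (\<lambda>x. sqrt (f x)) T v"]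
    by (metis blinfun_apply_blinfun_compose inner_ge_zero)
qed

lemma op_fun_mono:
  fixes T :: "'a::{real_inner,banach} op"
  assumes T: "sym_op T" and f: "continuous_on (op_spectrum T) f"
    and g: "continuous_on (op_spectrum T) g"
    and le: "\<And>x. x \<in> op_spectrum T \<Longrightarrow> f x \<le> g x"
  shows "inner v (op_fun f T v) \<le> inner v (op_fun g T v)"
proof -
  have "0 \<le> inner v (op_fun (\<lambda>x. g x - f x) T v)"
    by (rule op_fun_nonneg[OF T]) (use le in \<open>auto intro!: continuous_on_diff f g\<close>)
  then show ?thesis
    by (simp add: op_fun_diff[OF T g f] blinfun.bilinear_simps inner_simps)
qed

text \<open>
  For a polynomial \<open>g\<close> this follows from additivity and multiplicativity in \<open>f\<close>. In general,
  polynomials approximating \<open>g\<close> on the image of the spectrum do so on the spectrum of \<open>f(T)\<close>,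
  and their compositions with \<open>f\<close> approximate \<open>g \<circ> f\<close> on the spectrum of \<open>T\<close>.
\<close>

lemma op_fun_compose:
  fixes T :: "'a::{real_inner,banach} op"
  assumes T: "sym_op T" and f: "continuous_on (op_spectrum T) f"
    and g: "continuous_on (f ` op_spectrum T) g"
  shows "op_fun g (op_fun f T) = op_fun (\<lambda>x. g (f x)) T"
proof -
  note fT = sym_op_fun[OF T f]
  have gf: "continuous_on (op_spectrum T) (\<lambda>x. g (f x))"
    using continuous_on_compose[OF f g] by (simp add: comp_def)
  have cont: "continuous_on (op_spectrum T) (\<lambda>x. poly r (f x))" for r
    by (intro continuous_intros f)
  have poly: "op_poly r (op_fun f T) = op_fun (\<lambda>x. poly r (f x)) T" for r
  proof (induction r)
    case 0
    then show ?case using op_fun_const[OF T, of 0] by simp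
  next
    case (pCons a r)
    have "op_fun (\<lambda>x. a + f x * poly r (f x)) T
        = op_fun (\<lambda>x. a) T + (op_fun f T o\<^sub>L op_fun (\<lambda>x. poly r (f x)) T)"
      by (simp add: op_fun_add[OF T] op_fun_mult[OF T f cont] continuous_on_mult f cont)
    then show ?case using pCons.IH by (simp add: op_poly_pCons op_fun_const[OF T])
  qed
  obtain p where p: "uniform_limit (f ` op_spectrum T) (\<lambda>k x. poly (p k) x) g sequentially"
    using uniform_limit_polynomials[OF compact_continuous_image[OF f compact_op_spectrum[OF T]] g]
    by blast
  show ?thesis
  proof (rule op_fun_eqI[OF fT])
    show "uniform_limit (op_spectrum (op_fun f T)) (\<lambda>k x. poly (p k) x) g sequentially"
      by (rule uniform_limit_on_subset[OF p op_spectrum_op_fun[OF T f]])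
    show "(\<lambda>k. op_poly (p k) (op_fun f T)) \<longlonglongrightarrow> op_fun (\<lambda>x. g (f x)) T"
    proof (rule LIMSEQ_I)
      fix e :: real assume "0 < e"
      then obtain N where
        N: "\<And>k x. k \<ge> N \<Longrightarrow> x \<in> op_spectrum T \<Longrightarrow> dist (poly (p k) (f x)) (g (f x)) < e/2"
        using uniform_limitD[OF p, of "e/2"] unfolding eventually_sequentially by auto
      have "norm (op_poly (p k) (op_fun f T) - op_fun (\<lambda>x. g (f x)) T) < e" if "k \<ge> N" for k
      proof -
        have "norm (op_fun (\<lambda>x. poly (p k) (f x) - g (f x)) T) \<le> e/2"
          using N[OF that] \<open>0 < e\<close> by (intro norm_op_fun_le[OF T] continuous_on_diff cont gf)
            (auto simp: dist_real_def intro: less_imp_le)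
        then show ?thesis
          using \<open>0 < e\<close> by (simp add: poly op_fun_diff[OF T cont gf])
      qed
      then show "\<exists>N. \<forall>k\<ge>N. norm (op_poly (p k) (op_fun f T) - op_fun (\<lambda>x. g (f x)) T) < e"
        by blast
    qed
  qed
qed

section \<open>Hermitian operators and the Loewner order\<close>

instance complex_hilbert \<subseteq> banach ..

lemma norm_scaleC: "norm (c *\<^sub>C (x :: 'a::complex_hilbert)) = norm c * norm x"
proof -
  have r: "cinner y (c *\<^sub>C z) = c * cinner y z" for y z :: 'a
    by (subst cinner_commute)
      (simp add: cinner_scaleC_left cinner_commute[of y z])
  have "(norm (c *\<^sub>C x))\<^sup>2 = Re (cinner (c *\<^sub>C x) (c *\<^sub>C x))"
    by (simp add: power2_norm_eq_inner Re_cinner)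
  also have "\<dots> = Re ((c * cnj c) * cinner x x)"
    by (simp add: r cinner_scaleC_left algebra_simps)
  also have "\<dots> = (norm c)\<^sup>2 * Re (cinner x x)"
    by (simp add: complex_norm_square[symmetric] flip: of_real_power)
  also have "\<dots> = (norm c * norm x)\<^sup>2"
    by (simp add: Re_cinner power2_norm_eq_inner power_mult_distrib)
  finally show ?thesis by (simp add: power2_eq_iff_nonneg)
qed

text \<open>
  As an operator, multiplication by a scalar turns complex linearity into a commutation relation
  (\<open>clinear_op_iff\<close>), to which \<open>op_fun_intertwine\<close> applies.
\<close>

definition scaleC_op :: "complex \<Rightarrow> 'a::complex_hilbert op"
  where "scaleC_op c = Blinfun (\<lambda>x. c *\<^sub>C x)"

lemma scaleC_op_apply [simp]: "blinfun_apply (scaleC_op c) x = c *\<^sub>C x"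
proof -
  have "bounded_linear (\<lambda>x::'a. c *\<^sub>C x)"
  proof (rule bounded_linear_intro[where K = "norm c"])
    fix x y :: 'a and r
    show "c *\<^sub>C (x + y) = c *\<^sub>C x + c *\<^sub>C y" by (rule scaleC_add_right)
    show "c *\<^sub>C (r *\<^sub>R x) = r *\<^sub>R (c *\<^sub>C x)"
      by (simp add: scaleC_scaleC mult.commute flip: scaleC_of_real)
    show "norm (c *\<^sub>C x) \<le> norm x * norm c" by (simp add: norm_scaleC)
  qed
  then show ?thesis by (simp add: scaleC_op_def bounded_linear_Blinfun_apply)
qed

lemma clinear_op_iff: "clinear_op T \<longleftrightarrow> (\<forall>c. T o\<^sub>L scaleC_op c = scaleC_op c o\<^sub>L T)"
  unfolding clinear_op_def
  by (metis blinfun_apply_blinfun_compose blinfun_eqI scaleC_op_apply)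

definition hermitian_op :: "'a::complex_hilbert op \<Rightarrow> bool"
  where "hermitian_op T \<longleftrightarrow> clinear_op T \<and> sym_op T"

lemma hermitian_op_sym: "hermitian_op T \<Longrightarrow> sym_op T"
  by (simp add: hermitian_op_def)

lemma hermitian_op_id [simp]: "hermitian_op id_blinfun"
  by (simp add: hermitian_op_def clinear_op_iff)

lemma hermitian_op_0 [simp]: "hermitian_op 0"
  by (simp add: hermitian_op_def clinear_op_iff)

lemma hermitian_op_add: "hermitian_op S \<Longrightarrow> hermitian_op T \<Longrightarrow> hermitian_op (S + T)"
  by (simp add: hermitian_op_def clinear_op_iff sym_op_add blinfun_compose_simps)

lemma hermitian_op_diff: "hermitian_op S \<Longrightarrow> hermitian_op T \<Longrightarrow> hermitian_op (S - T)"
  by (simp add: hermitian_op_def clinear_op_iff sym_op_diff blinfun_compose_simps)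

lemma hermitian_op_scaleR: "hermitian_op T \<Longrightarrow> hermitian_op (c *\<^sub>R T)"
  by (simp add: hermitian_op_def clinear_op_iff sym_op_scaleR blinfun_compose_simps)

lemma hermitian_op_sandwich:
  "hermitian_op C \<Longrightarrow> hermitian_op T \<Longrightarrow> hermitian_op (C o\<^sub>L T o\<^sub>L C)"
  by (simp add: hermitian_op_def clinear_op_def sym_op_sandwich)

lemma hermitian_op_limit:
  assumes "\<And>k. hermitian_op (T k)" "T \<longlonglongrightarrow> S"
  shows "hermitian_op S"
proof -
  have "S o\<^sub>L scaleC_op c = scaleC_op c o\<^sub>L S" for c
  proof (rule LIMSEQ_unique)
    show "(\<lambda>k. T k o\<^sub>L scaleC_op c) \<longlonglongrightarrow> (S o\<^sub>L scaleC_op c)"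
      by (intro bounded_bilinear.tendsto[OF bounded_bilinear_blinfun_compose] tendsto_const assms)
    have "(\<lambda>k. scaleC_op c o\<^sub>L T k) \<longlonglongrightarrow> (scaleC_op c o\<^sub>L S)"
      by (intro bounded_bilinear.tendsto[OF bounded_bilinear_blinfun_compose] tendsto_const assms)
    then show "(\<lambda>k. T k o\<^sub>L scaleC_op c) \<longlonglongrightarrow> (scaleC_op c o\<^sub>L S)"
      using assms(1) by (simp add: hermitian_op_def clinear_op_iff)
  qed
  moreover have "sym_op S"
    using assms by (auto intro: sym_op_limit simp: hermitian_op_def)
  ultimately show ?thesis by (simp add: hermitian_op_def clinear_op_iff)
qed

lemma hermitian_op_fun:
  assumes T: "hermitian_op T" and f: "continuous_on (op_spectrum T) f"
  shows "hermitian_op (op_fun f T)"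
  using assms sym_op_fun[OF hermitian_op_sym[OF T] f]
    op_fun_intertwine[OF hermitian_op_sym[OF T] hermitian_op_sym[OF T]]
  by (simp add: hermitian_op_def clinear_op_iff)

lemma inner_scaleC_ii: "inner x (\<i> *\<^sub>C y) = - Im (cinner x y)"
  "inner (\<i> *\<^sub>C x) y = Im (cinner x y)"
proof -
  show "inner (\<i> *\<^sub>C x) y = Im (cinner x y)" for x y :: 'a
    by (simp add: cinner_scaleC_left flip: Re_cinner)
  from this[of y x] show "inner x (\<i> *\<^sub>C y) = - Im (cinner x y)"
    by (simp add: inner_commute cinner_commute[of x y])
qed

text \<open>
  A real-valued form \<open>\<langle>x, T x\<rangle>\<close> means that \<open>x\<close> and \<open>\<i> T x\<close> are orthogonal for the real inner
  product. Polarising this identity and substituting \<open>\<i> u\<close> for one of the two vectors gives the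
  symmetry of \<open>T\<close>.
\<close>

lemma pos_semidef_iff:
  "pos_semidef T \<longleftrightarrow> hermitian_op T \<and> (\<forall>x. 0 \<le> inner x (T x))"
proof
  assume T: "pos_semidef T"
  then have lin: "T (c *\<^sub>C x) = c *\<^sub>C T x" for c x
    by (simp add: pos_semidef_def clinear_op_def)
  have "Im (cinner x (T x)) = 0" for x
    using T by (simp add: pos_semidef_def complex_is_Real_iff)
  then have skew: "inner x (\<i> *\<^sub>C T x) = 0" for x
    by (simp add: inner_scaleC_ii)
  have skew2: "inner x (T (\<i> *\<^sub>C y)) + inner y (T (\<i> *\<^sub>C x)) = 0" for x y
    using skew[of "x + y"] skew[of x] skew[of y]
    by (simp add: lin[symmetric] scaleC_add_right blinfun.bilinear_simps inner_simps)
  have "inner (T x) y = inner x (T y)" for x y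
  proof -
    define u where "u = (- \<i>) *\<^sub>C y"
    have y: "y = \<i> *\<^sub>C u"
      using scaleC_of_real[of 1 y] by (simp add: u_def scaleC_scaleC)
    have "inner x (T y) = - inner u (\<i> *\<^sub>C T x)"
      using skew2[of x u] by (simp add: y lin)
    also have "\<dots> = inner y (T x)"
      by (simp add: y inner_scaleC_ii)
    finally show ?thesis by (simp add: inner_commute)
  qed
  then show "hermitian_op T \<and> (\<forall>x. 0 \<le> inner x (T x))"
    using T by (auto simp: pos_semidef_def hermitian_op_def sym_op_def Re_cinner)
next
  assume T: "hermitian_op T \<and> (\<forall>x. 0 \<le> inner x (T x))"
  have "Im (cinner x (T x)) = 0" for x
  proof -
    have "inner (\<i> *\<^sub>C x) (T x) = inner (T (\<i> *\<^sub>C x)) x"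
      using T by (simp add: hermitian_op_def sym_op_def)
    also have "\<dots> = inner x (\<i> *\<^sub>C T x)"
      using T by (simp add: hermitian_op_def clinear_op_def inner_commute)
    finally show ?thesis by (simp add: inner_scaleC_ii)
  qed
  then show "pos_semidef T"
    using T by (simp add: pos_semidef_def hermitian_op_def complex_is_Real_iff Re_cinner)
qed

lemma loewner_le_iff:
  assumes "hermitian_op S" "hermitian_op T"
  shows "S \<le>\<^sub>L T \<longleftrightarrow> (\<forall>x. inner x (S x) \<le> inner x (T x))"
  using assms
  by (simp add: loewner_le_def pos_semidef_iff hermitian_op_diff blinfun.bilinear_simps inner_simps)

lemma loewner_leD: "S \<le>\<^sub>L T \<Longrightarrow> inner x (S x) \<le> inner x (T x)"
  by (simp add: loewner_le_def pos_semidef_iff blinfun.bilinear_simps inner_simps)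

lemma loewner_le_refl [simp]: "T \<le>\<^sub>L T"
  by (simp add: loewner_le_def pos_semidef_iff)

lemma loewner_le_trans [trans]:
  assumes "R \<le>\<^sub>L S" "S \<le>\<^sub>L T"
  shows "R \<le>\<^sub>L T"
proof -
  have "hermitian_op ((S - R) + (T - S))"
    using assms by (intro hermitian_op_add) (auto simp: loewner_le_def pos_semidef_iff)
  moreover have "inner x (R x) \<le> inner x (T x)" for x
    using loewner_leD[OF assms(1), of x] loewner_leD[OF assms(2), of x] by simp
  ultimately show ?thesis
    by (simp add: loewner_le_def pos_semidef_iff blinfun.bilinear_simps inner_simps)
qed

text \<open>
  A symmetric operator with vanishing quadratic form is zero, by polarisation at \<open>D y\<close> and \<open>y\<close>.
\<close>

lemma loewner_le_antisym:
  assumes "S \<le>\<^sub>L T" "T \<le>\<^sub>L S"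
  shows "S = T"
proof -
  define D where "D = T - S"
  have "sym_op D" using assms by (simp add: D_def loewner_le_def pos_semidef_iff hermitian_op_def)
  have zero: "inner x (D x) = 0" for x
    using loewner_leD[OF assms(1), of x] loewner_leD[OF assms(2), of x]
    by (simp add: D_def blinfun.bilinear_simps inner_simps)
  have "D y = 0" for y
  proof -
    have "inner (D y) (D y) = 0"
      using zero[of "D y + y"] zero[of "D y"] zero[of y] sym_opD[OF \<open>sym_op D\<close>, of y "D y"]
      by (simp add: blinfun.bilinear_simps inner_simps)
    then show ?thesis by simp
  qed
  then show ?thesis by (intro blinfun_eqI) (simp add: D_def blinfun.bilinear_simps)
qed

lemma loewner_le_sandwich:
  assumes "S \<le>\<^sub>L T" "hermitian_op C"
  shows "C o\<^sub>L S o\<^sub>L C \<le>\<^sub>L C o\<^sub>L T o\<^sub>L C"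
proof -
  have "hermitian_op (C o\<^sub>L (T - S) o\<^sub>L C)"
    using assms by (intro hermitian_op_sandwich) (simp_all add: loewner_le_def pos_semidef_iff)
  moreover have "inner x (C (S (C x))) \<le> inner x (C (T (C x)))" for x
    using loewner_leD[OF assms(1), of "C x"]
      sym_opD[OF hermitian_op_sym[OF assms(2)], of x "S (C x)"]
      sym_opD[OF hermitian_op_sym[OF assms(2)], of x "T (C x)"] by simp
  ultimately show ?thesis
    by (simp add: loewner_le_def pos_semidef_iff blinfun_compose_simps blinfun.bilinear_simps inner_simps)
qed

lemma loewner_le_add: "S \<le>\<^sub>L T \<Longrightarrow> S' \<le>\<^sub>L T' \<Longrightarrow> S + S' \<le>\<^sub>L T + T'"
proof -
  assume "S \<le>\<^sub>L T" "S' \<le>\<^sub>L T'"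
  then have "pos_semidef ((T - S) + (T' - S'))"
    unfolding loewner_le_def pos_semidef_iff
    by (simp add: hermitian_op_add blinfun.add_left inner_add_right)
  then show ?thesis by (simp add: loewner_le_def algebra_simps)
qed

lemma loewner_le_scaleR:
  assumes "S \<le>\<^sub>L T" "0 \<le> c"
  shows "c *\<^sub>R S \<le>\<^sub>L c *\<^sub>R T"
proof -
  have "pos_semidef (c *\<^sub>R (T - S))"
    using assms unfolding loewner_le_def pos_semidef_iff
    by (simp add: hermitian_op_scaleR blinfun.scaleR_left)
  then show ?thesis by (simp add: loewner_le_def scaleR_diff_right)
qed

lemma loewner_le_scaleR_left:
  assumes "pos_semidef T" "c \<le> d"
  shows "c *\<^sub>R T \<le>\<^sub>L d *\<^sub>R T"
proof -
  have "pos_semidef ((d - c) *\<^sub>R T)"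
    using assms by (simp add: pos_semidef_iff hermitian_op_scaleR blinfun.scaleR_left)
  then show ?thesis by (simp add: loewner_le_def scaleR_diff_left)
qed

lemma loewner_le_sum:
  "(\<And>j. j \<in> J \<Longrightarrow> S j \<le>\<^sub>L T j) \<Longrightarrow> (\<Sum>j\<in>J. S j) \<le>\<^sub>L (\<Sum>j\<in>J. T j)"
  by (induction J rule: infinite_finite_induct) (auto intro: loewner_le_add)

text \<open>
  Both the Loewner--Heinz inequality and the fixed point theorem prove an inequality up to
  constants that tend to \<open>1\<close>.
\<close>

lemma loewner_le_scaleR_limit:
  assumes ST: "\<And>k::nat. S \<le>\<^sub>L c k *\<^sub>R T" and c: "c \<longlonglongrightarrow> 1"
    and "hermitian_op S" "hermitian_op T"
  shows "S \<le>\<^sub>L T"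
proof -
  have "inner v (S v) \<le> inner v (T v)" for v
  proof -
    have "(\<lambda>k. c k * inner v (T v)) \<longlonglongrightarrow> 1 * inner v (T v)"
      by (intro tendsto_mult c tendsto_const)
    then have "inner v (S v) \<le> 1 * inner v (T v)"
      using loewner_leD[OF ST, of v]
      by (intro LIMSEQ_le_const) (auto simp: blinfun.scaleR_left)
    then show ?thesis by simp
  qed
  then show ?thesis using assms(3,4) by (simp add: loewner_le_iff)
qed

section \<open>Positive definite operators and their real powers\<close>

lemma op_spectrum_ge:
  fixes T :: "'a::{real_inner,banach} op"
  assumes "\<And>v. m * (norm v)\<^sup>2 \<le> inner v (T v)" "x \<in> op_spectrum T"
  shows "m \<le> x"
proof (rule ccontr)
  assume "\<not> m \<le> x"
  have "invertible_op (T - x *\<^sub>R id_blinfun)"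
  proof (rule coercive_op_invertible)
    show "0 < m - x" using \<open>\<not> m \<le> x\<close> by simp
    show "(m - x) * (norm v)\<^sup>2 \<le> inner v ((T - x *\<^sub>R id_blinfun) v)" for v
      using assms(1)[of v]
      by (simp add: blinfun.bilinear_simps inner_simps power2_norm_eq_inner algebra_simps)
  qed
  then show False using assms(2) by (simp add: op_spectrum_def)
qed

lemma op_spectrum_le:
  fixes T :: "'a::{real_inner,banach} op"
  assumes "\<And>v. inner v (T v) \<le> m * (norm v)\<^sup>2" "x \<in> op_spectrum T"
  shows "x \<le> m"
proof (rule ccontr)
  assume "\<not> x \<le> m"
  have "invertible_op (x *\<^sub>R id_blinfun - T)"
  proof (rule coercive_op_invertible)
    show "0 < x - m" using \<open>\<not> x \<le> m\<close> by simp
    show "(x - m) * (norm v)\<^sup>2 \<le> inner v ((x *\<^sub>R id_blinfun - T) v)" for v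
      using assms(1)[of v]
      by (simp add: blinfun.bilinear_simps inner_simps power2_norm_eq_inner algebra_simps)
  qed
  then have "invertible_op ((-1) *\<^sub>R (x *\<^sub>R id_blinfun - T))"
    by (intro invertible_op_scaleR) auto
  then show False using assms(2) by (simp add: op_spectrum_def)
qed

lemma norm_sym_op_le:
  fixes T :: "'a::{real_inner,banach} op"
  assumes "sym_op T" "0 \<le> c" "\<And>v. \<bar>inner v (T v)\<bar> \<le> c * (norm v)\<^sup>2"
  shows "norm T \<le> c"
proof (rule norm_sym_op_le_if_spectrum_le[OF assms(1,2)])
  fix x assume x: "x \<in> op_spectrum T"
  have "inner v (T v) \<le> c * (norm v)\<^sup>2" "- c * (norm v)\<^sup>2 \<le> inner v (T v)" for v
    using assms(3)[of v] by (simp_all add: abs_le_iff)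
  then show "\<bar>x\<bar> \<le> c"
    using op_spectrum_le[of T c x] op_spectrum_ge[of "-c" T x] x by (simp add: abs_le_iff)
qed

lemma sym_op_ge_if_spectrum_ge:
  fixes T :: "'a::{real_inner,banach} op"
  assumes T: "sym_op T" and "\<And>x. x \<in> op_spectrum T \<Longrightarrow> m \<le> x"
  shows "m * (norm v)\<^sup>2 \<le> inner v (T v)"
  using op_fun_mono[OF T continuous_on_const continuous_on_id, of m v] assms(2)
  by (simp add: op_fun_const[OF T] op_fun_ident[OF T] blinfun.bilinear_simps power2_norm_eq_inner)

text \<open>
  The spectrum lies in \<open>{0..}\<close>, is closed and misses \<open>0\<close>, so it keeps some distance \<open>m\<close> from \<open>0\<close>.
\<close>

lemma pos_def_coercive:
  assumes "pos_def T"
  obtains m where "0 < m" "\<And>v. m * (norm v)\<^sup>2 \<le> inner v (T v)"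
proof -
  have T: "sym_op T" and nonneg: "\<And>v. 0 \<le> inner v (T v)" and inv: "0 \<notin> op_spectrum T"
    using assms by (auto simp: pos_def_def pos_semidef_iff hermitian_op_def op_spectrum_def)
  have "open (- op_spectrum T)"
    using compact_op_spectrum[OF T] by (simp add: compact_imp_closed open_Compl)
  then obtain m where m: "0 < m" "\<And>x. dist x 0 < m \<Longrightarrow> x \<notin> op_spectrum T"
    using inv unfolding open_dist by (metis ComplD ComplI)
  have "m \<le> x" if "x \<in> op_spectrum T" for x
  proof -
    have "0 \<le> x" using op_spectrum_ge[of 0 T x] nonneg that by simp
    then show ?thesis using m(2)[of x] that by (cases "m \<le> x") (simp_all add: dist_real_def)
  qed
  then show thesis using that m(1) sym_op_ge_if_spectrum_ge[OF T] by blast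
qed

lemma pos_defI_coercive:
  assumes "hermitian_op T" "0 < m" "\<And>v. m * (norm v)\<^sup>2 \<le> inner v (T v)"
  shows "pos_def T"
proof -
  have "0 \<le> inner v (T v)" for v
    using assms(3)[of v] \<open>0 < m\<close> by (meson mult_nonneg_nonneg less_imp_le order.trans zero_le_power2)
  then show ?thesis
    using assms(1) coercive_op_invertible[OF assms(2,3)] by (simp add: pos_def_def pos_semidef_iff)
qed

lemma pos_def_hermitian: "pos_def T \<Longrightarrow> hermitian_op T"
  by (simp add: pos_def_def pos_semidef_iff)

lemma pos_def_sym: "pos_def T \<Longrightarrow> sym_op T"
  by (simp add: pos_def_hermitian hermitian_op_sym)

lemma pos_def_spectrum_pos:
  assumes "pos_def T" "x \<in> op_spectrum T"
  shows "0 < x"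
proof -
  obtain m where "0 < m" "\<And>v. m * (norm v)\<^sup>2 \<le> inner v (T v)"
    using pos_def_coercive[OF assms(1)] by blast
  then show ?thesis using op_spectrum_ge[of m T x] assms(2) by simp
qed

lemma pos_defI_spectrum:
  assumes "hermitian_op T" "\<And>x. x \<in> op_spectrum T \<Longrightarrow> 0 < x"
  shows "pos_def T"
proof -
  have "0 \<le> inner v (T v)" for v
    using sym_op_ge_if_spectrum_ge[OF hermitian_op_sym[OF assms(1)], of 0 v] assms(2)
    by (simp add: less_imp_le)
  moreover have "invertible_op T" using assms(2)[of 0] by (auto simp: op_spectrum_def)
  ultimately show ?thesis using assms(1) by (simp add: pos_def_def pos_semidef_iff)
qed

lemma pos_def_id [simp]: "pos_def id_blinfun"
  by (rule pos_defI_coercive[of _ 1]) (simp_all add: power2_norm_eq_inner)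

lemma pos_def_scaleR:
  assumes "pos_def T" "0 < c"
  shows "pos_def (c *\<^sub>R T)"
  using assms unfolding pos_def_def pos_semidef_iff
  by (simp add: hermitian_op_scaleR invertible_op_scaleR blinfun.scaleR_left)

lemma pos_def_mono:
  assumes "pos_def S" "S \<le>\<^sub>L T" "hermitian_op T"
  shows "pos_def T"
proof -
  obtain m where "0 < m" "\<And>v. m * (norm v)\<^sup>2 \<le> inner v (S v)"
    using pos_def_coercive[OF assms(1)] by blast
  then show ?thesis
    using loewner_leD[OF assms(2)] assms(3) by (meson order_trans pos_defI_coercive)
qed

lemma pos_def_add:
  assumes "pos_def S" "pos_def T"
  shows "pos_def (S + T)"
  by (rule pos_def_mono[OF assms(1)])
    (use assms in \<open>simp_all add: loewner_le_def pos_def_def hermitian_op_add pos_semidef_iff\<close>)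

lemma pos_def_sum:
  assumes "finite J" "J \<noteq> {}" "\<And>j. j \<in> J \<Longrightarrow> pos_def (T j)"
  shows "pos_def (\<Sum>j\<in>J. T j)"
  using assms by (induction J rule: finite_ne_induct) (auto intro: pos_def_add)

lemma pos_def_sandwich:
  assumes "pos_def T" "pos_def C"
  shows "pos_def (C o\<^sub>L T o\<^sub>L C)"
proof -
  have "0 \<le> inner x (C (T (C x)))" for x
    using assms sym_opD[OF pos_def_sym[OF assms(2)], of x "T (C x)"]
    by (metis pos_def_def pos_semidef_iff)
  moreover have "invertible_op (C o\<^sub>L T o\<^sub>L C)"
    using assms by (simp add: pos_def_def invertible_op_compose)
  ultimately show ?thesis
    using assms by (simp add: pos_def_def pos_semidef_iff hermitian_op_sandwich)
qed

lemma continuous_on_powr_spectrum: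
  "pos_def T \<Longrightarrow> continuous_on (op_spectrum T) (\<lambda>x. x powr s)"
  by (intro continuous_intros) (use pos_def_spectrum_pos in force)

lemma pos_def_op_powr:
  assumes "pos_def T"
  shows "pos_def (op_powr T s)"
  unfolding op_powr_def
proof (rule pos_defI_spectrum)
  show "hermitian_op (op_fun (\<lambda>x. x powr s) T)"
    by (intro hermitian_op_fun pos_def_hermitian continuous_on_powr_spectrum assms)
  show "0 < x" if "x \<in> op_spectrum (op_fun (\<lambda>x. x powr s) T)" for x
    using that op_spectrum_op_fun[OF pos_def_sym continuous_on_powr_spectrum, OF assms assms]
      pos_def_spectrum_pos[OF assms] by fastforce
qed

lemma hermitian_op_powr: "pos_def T \<Longrightarrow> hermitian_op (op_powr T s)"
  by (intro pos_def_hermitian pos_def_op_powr)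

lemma op_powr_compose:
  assumes "pos_def T"
  shows "op_powr T s o\<^sub>L op_powr T u = op_powr T (s + u)"
  unfolding op_powr_def powr_add
  using assms by (simp add: op_fun_mult pos_def_sym continuous_on_powr_spectrum)

lemma op_powr_compose_left:
  assumes "pos_def T"
  shows "op_powr T s o\<^sub>L (op_powr T u o\<^sub>L Z) = op_powr T (s + u) o\<^sub>L Z"
  by (simp add: op_powr_compose[OF assms] flip: blinfun_compose_assoc)

lemma op_powr_0: "pos_def T \<Longrightarrow> op_powr T 0 = id_blinfun"
  unfolding op_powr_def
  using op_fun_cong[of T "\<lambda>x. x powr 0" "\<lambda>x. 1"] op_fun_const[OF pos_def_sym, of T 1]
    pos_def_spectrum_pos[of T] by force

lemma op_powr_1: "pos_def T \<Longrightarrow> op_powr T 1 = T"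
  unfolding op_powr_def
  using op_fun_cong[of T "\<lambda>x. x powr 1" "\<lambda>x. x"] op_fun_ident[OF pos_def_sym, of T]
    pos_def_spectrum_pos[of T] by force

lemma op_powr_powr:
  assumes "pos_def T"
  shows "op_powr (op_powr T s) u = op_powr T (s * u)"
proof -
  have "continuous_on ((\<lambda>x. x powr s) ` op_spectrum T) (\<lambda>y. y powr u)"
    by (intro continuous_intros) (use pos_def_spectrum_pos[OF assms] in force)
  then show ?thesis
    unfolding op_powr_def
    by (simp add: op_fun_compose[OF pos_def_sym continuous_on_powr_spectrum] assms powr_powr)
qed

lemma op_powr_scaleR:
  assumes "pos_def T" "0 < c"
  shows "op_powr (c *\<^sub>R T) s = (c powr s) *\<^sub>R op_powr T s"
proof -
  note T = pos_def_sym[OF assms(1)] and cont = continuous_on_powr_spectrum[OF assms(1)]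
  have "continuous_on ((\<lambda>x. c * x) ` op_spectrum T) (\<lambda>y. y powr s)"
    by (intro continuous_intros) (use pos_def_spectrum_pos[OF assms(1)] assms(2) in force)
  moreover have "c *\<^sub>R T = op_fun (\<lambda>x. c * x) T"
    by (simp add: op_fun_mult[OF T] continuous_intros op_fun_const[OF T] op_fun_ident[OF T]
        blinfun_compose_simps)
  ultimately have "op_powr (c *\<^sub>R T) s = op_fun (\<lambda>x. (c * x) powr s) T"
    unfolding op_powr_def by (simp add: op_fun_compose[OF T] continuous_intros)
  also have "\<dots> = op_fun (\<lambda>x. c powr s * x powr s) T"
    by (rule op_fun_cong) (use pos_def_spectrum_pos[OF assms(1)] assms(2) in
        \<open>simp add: powr_mult less_imp_le\<close>)
  also have "\<dots> = (c powr s) *\<^sub>R op_powr T s"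
    by (simp add: op_fun_mult[OF T] continuous_intros cont op_fun_const[OF T] op_powr_def
        blinfun_compose_simps)
  finally show ?thesis .
qed

lemma op_inv_eq_powr:
  assumes "pos_def T"
  shows "op_inv T = op_powr T (-1)"
proof (rule op_inv_eqI)
  have "op_powr T 1 o\<^sub>L op_powr T (-1) = id_blinfun" "op_powr T (-1) o\<^sub>L op_powr T 1 = id_blinfun"
    by (simp_all add: op_powr_compose op_powr_0 assms)
  then show "T o\<^sub>L op_powr T (-1) = id_blinfun" "op_powr T (-1) o\<^sub>L T = id_blinfun"
    by (simp_all add: op_powr_1 assms)
qed

lemma op_powr_le_spectrum:
  assumes "pos_def T" "\<And>x. x \<in> op_spectrum T \<Longrightarrow> x powr s \<le> c"
  shows "op_powr T s \<le>\<^sub>L c *\<^sub>R id_blinfun"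
proof -
  note T = pos_def_sym[OF assms(1)] and cont = continuous_on_powr_spectrum[OF assms(1)]
  have "inner v (op_powr T s v) \<le> inner v (op_fun (\<lambda>x. c) T v)" for v
    unfolding op_powr_def by (rule op_fun_mono[OF T cont]) (simp_all add: assms(2))
  then show ?thesis
    by (simp add: loewner_le_iff hermitian_op_powr assms hermitian_op_scaleR op_fun_const[OF T])
qed

lemma op_powr_ge_spectrum:
  assumes "pos_def T" "\<And>x. x \<in> op_spectrum T \<Longrightarrow> c \<le> x powr s"
  shows "c *\<^sub>R id_blinfun \<le>\<^sub>L op_powr T s"
proof -
  note T = pos_def_sym[OF assms(1)] and cont = continuous_on_powr_spectrum[OF assms(1)]
  have "inner v (op_fun (\<lambda>x. c) T v) \<le> inner v (op_powr T s v)" for v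
    unfolding op_powr_def by (rule op_fun_mono[OF T _ cont]) (simp_all add: assms(2))
  then show ?thesis
    by (simp add: loewner_le_iff hermitian_op_powr assms hermitian_op_scaleR op_fun_const[OF T])
qed

section \<open>The Loewner--Heinz inequality\<close>

lemma op_powr_half_norm:
  assumes "pos_def T"
  shows "(norm (op_powr T (s/2) v))\<^sup>2 = inner v (op_powr T s v)"
proof -
  have "op_powr T (s/2) o\<^sub>L op_powr T (s/2) = op_powr T s"
    by (simp add: op_powr_compose assms)
  then have "op_powr T (s/2) (op_powr T (s/2) v) = op_powr T s v"
    by (metis blinfun_apply_blinfun_compose)
  then show ?thesis
    by (simp add: power2_norm_eq_inner sym_opD[OF pos_def_sym[OF pos_def_op_powr[OF assms]]])
qed

lemma op_powr_cancel_sandwich: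
  assumes "pos_def T"
  shows "op_powr T s o\<^sub>L (op_powr T (-s) o\<^sub>L X o\<^sub>L op_powr T (-s)) o\<^sub>L op_powr T s = X"
  by (simp add: blinfun_compose_assoc op_powr_compose op_powr_compose_left op_powr_0 assms)

lemma op_powr_sandwich_id:
  assumes "pos_def T"
  shows "op_powr T s o\<^sub>L (c *\<^sub>R id_blinfun) o\<^sub>L op_powr T s = c *\<^sub>R op_powr T (2 * s)"
  by (simp add: blinfun_compose_simps op_powr_compose assms)

text \<open>
  With \<open>y = B\<^bsup>-s/2\<^esup> x\<close> the hypothesis at \<open>y\<close> reads \<open>\<parallel>A\<^bsup>s/2\<^esup> y\<parallel>\<^sup>2 \<le> a \<parallel>x\<parallel>\<^sup>2\<close>.
\<close>

lemma norm_op_powr_quotient_le: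
  assumes A: "pos_def A" and B: "pos_def B" and "0 \<le> a"
    and le: "op_powr A s \<le>\<^sub>L a *\<^sub>R op_powr B s"
  shows "norm (op_powr A (s/2) (op_powr B (-s/2) x)) \<le> sqrt a * norm x"
proof (rule power2_le_imp_le)
  let ?y = "op_powr B (-s/2) x"
  have "op_powr B (s/2) o\<^sub>L op_powr B (-s/2) = id_blinfun"
    by (simp add: op_powr_compose op_powr_0 B)
  then have "op_powr B (s/2) ?y = x"
    by (metis blinfun_apply_blinfun_compose blinfun_apply_id_blinfun)
  then have "inner ?y (op_powr B s ?y) = (norm x)\<^sup>2"
    using op_powr_half_norm[OF B, of s ?y] by simp
  then show "(norm (op_powr A (s/2) ?y))\<^sup>2 \<le> (sqrt a * norm x)\<^sup>2"
    using loewner_leD[OF le, of ?y] \<open>0 \<le> a\<close>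
    by (simp add: op_powr_half_norm[OF A] blinfun.scaleR_left power_mult_distrib)
qed (use \<open>0 \<le> a\<close> in simp)

text \<open>
  Similar operators have the same spectrum, and the spectrum of a hermitian operator bounds its
  quadratic form. So a norm bound for \<open>N\<close> controls \<open>M\<close>, although \<open>N\<close> may fail to be symmetric.
\<close>

lemma hermitian_op_le_if_similar:
  fixes M N :: "'a::complex_hilbert op"
  assumes M: "hermitian_op M" and inv: "P o\<^sub>L P' = id_blinfun" "invertible_op P" "invertible_op P'"
    and MN: "M = P o\<^sub>L N o\<^sub>L P'"
    and N: "\<And>x. norm (N x) \<le> c * norm x"
  shows "M \<le>\<^sub>L c *\<^sub>R id_blinfun"
proof -
  have "l \<le> c" if l: "l \<in> op_spectrum M" for l
  proof (rule op_spectrum_le[of N c l])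
    show "inner v (N v) \<le> c * (norm v)\<^sup>2" for v
      using norm_cauchy_schwarz[of v "N v"] mult_left_mono[OF N[of v], of "norm v"]
      by (simp add: power2_eq_square mult.left_commute)
    have "P o\<^sub>L (N - l *\<^sub>R id_blinfun) o\<^sub>L P' = M - l *\<^sub>R id_blinfun"
      by (simp add: MN inv blinfun_compose_simps)
    then show "l \<in> op_spectrum N"
      using l inv invertible_op_compose unfolding op_spectrum_def by (metis mem_Collect_eq)
  qed
  then have "inner v (op_fun (\<lambda>x. x) M v) \<le> inner v (op_fun (\<lambda>x. c) M v)" for v
    by (intro op_fun_mono hermitian_op_sym M continuous_intros)
  then show ?thesis
    using M by (simp add: loewner_le_iff hermitian_op_scaleR op_fun_ident op_fun_const hermitian_op_sym)
qed

text \<open>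
  The best constants \<open>c(s)\<close> with \<open>A\<^bsup>s\<^esup> \<le> c(s) B\<^bsup>s\<^esup>\<close> are logarithmically midpoint-convex in \<open>s\<close>.
  With \<open>m = (s + u) / 2\<close>, the operator \<open>N = B\<^bsup>-s/2\<^esup> A\<^bsup>m\<^esup> B\<^bsup>-u/2\<^esup>\<close> is the adjoint of
  \<open>A\<^bsup>s/2\<^esup> B\<^bsup>-s/2\<^esup>\<close> times \<open>A\<^bsup>u/2\<^esup> B\<^bsup>-u/2\<^esup>\<close>, so its norm is at most \<open>sqrt (a b)\<close>, and it is similar to the
  hermitian operator \<open>M = B\<^bsup>-m/2\<^esup> A\<^bsup>m\<^esup> B\<^bsup>-m/2\<^esup>\<close>. Hence \<open>M \<le> sqrt (a b) I\<close>.
\<close>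

lemma op_powr_le_midpoint:
  assumes A: "pos_def A" and B: "pos_def B" and "0 \<le> a" "0 \<le> b"
    and s: "op_powr A s \<le>\<^sub>L a *\<^sub>R op_powr B s"
    and u: "op_powr A u \<le>\<^sub>L b *\<^sub>R op_powr B u"
  shows "op_powr A ((s + u)/2) \<le>\<^sub>L sqrt (a * b) *\<^sub>R op_powr B ((s + u)/2)"
proof -
  define h where "h = (s + u)/4"
  \<comment> \<open>The exponent \<open>e\<close> is chosen so that conjugating \<open>N\<close> by the \<open>e\<close>-th power of \<open>B\<close>
    balances its two outer factors.\<close>
  define e where "e = (s - u)/4"
  define N where "N = op_powr B (-s/2) o\<^sub>L op_powr A ((s + u)/2) o\<^sub>L op_powr B (-u/2)"
  define M where "M = op_powr B (-h) o\<^sub>L op_powr A ((s + u)/2) o\<^sub>L op_powr B (-h)"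
  have "norm (N y) \<le> sqrt (a * b) * norm y" for y
  proof (cases "N y = 0")
    case False
    have "op_powr A ((s + u)/2) = op_powr A (s/2) o\<^sub>L op_powr A (u/2)"
      by (simp add: op_powr_compose A add_divide_distrib)
    then have "norm (N y) * norm (N y)
        = inner (N y) (op_powr B (-s/2) (op_powr A (s/2) (op_powr A (u/2) (op_powr B (-u/2) y))))"
      by (simp add: N_def dot_square_norm power2_eq_square)
    also have "\<dots> = inner (op_powr A (s/2) (op_powr B (-s/2) (N y)))
        (op_powr A (u/2) (op_powr B (-u/2) y))"
      by (simp add: sym_opD[OF pos_def_sym] pos_def_op_powr A B)
    also have "\<dots> \<le> (sqrt a * norm (N y)) * (sqrt b * norm y)"
      by (intro order.trans[OF norm_cauchy_schwarz] mult_mono norm_op_powr_quotient_le A B assms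
          mult_nonneg_nonneg) (simp_all add: \<open>0 \<le> a\<close>)
    also have "\<dots> = sqrt (a * b) * norm y * norm (N y)"
      by (simp add: real_sqrt_mult algebra_simps)
    finally show ?thesis using False by simp
  qed (use assms in simp)
  moreover have "M = op_powr B e o\<^sub>L N o\<^sub>L op_powr B (-e)"
  proof -
    have "e + (- s/2) = - h" "- u/2 + - e = - h" by (simp_all add: h_def e_def field_simps)
    then have "M = (op_powr B e o\<^sub>L op_powr B (- s/2)) o\<^sub>L op_powr A ((s + u)/2)
        o\<^sub>L (op_powr B (- u/2) o\<^sub>L op_powr B (- e))"
      by (simp only: op_powr_compose[OF B] M_def)
    then show ?thesis by (simp only: N_def blinfun_compose_assoc)
  qed
  moreover have "op_powr B e o\<^sub>L op_powr B (-e) = id_blinfun"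
    by (simp add: op_powr_compose op_powr_0 B)
  moreover have "invertible_op (op_powr B e)" "invertible_op (op_powr B (-e))"
    using pos_def_op_powr[OF B] by (simp_all add: pos_def_def)
  moreover have "hermitian_op M"
    unfolding M_def by (intro hermitian_op_sandwich hermitian_op_powr A B)
  ultimately have "M \<le>\<^sub>L sqrt (a * b) *\<^sub>R id_blinfun"
    by (intro hermitian_op_le_if_similar[of M "op_powr B e" "op_powr B (-e)" N])
  moreover have "2 * h = (s + u)/2" by (simp add: h_def)
  ultimately show ?thesis
    using loewner_le_sandwich[OF _ hermitian_op_powr[OF B, of h]]
    by (metis M_def op_powr_cancel_sandwich[OF B] op_powr_sandwich_id[OF B])
qed

text \<open>
  The spectra bound the powers by \<open>A\<^bsup>s\<^esup> \<le> K I\<close> and \<open>m I \<le> B\<^bsup>s\<^esup>\<close>; what matters is that one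
  constant serves all \<open>s\<close> in the unit interval.
\<close>

lemma powr_loewner_bound:
  assumes A: "pos_def A" and B: "pos_def B"
  obtains M where "1 \<le> M" "\<And>s. 0 \<le> s \<Longrightarrow> s \<le> 1 \<Longrightarrow> op_powr A s \<le>\<^sub>L M *\<^sub>R op_powr B s"
proof -
  obtain b where b: "0 < b" "\<And>v. b * (norm v)\<^sup>2 \<le> inner v (B v)"
    using pos_def_coercive[OF B] by blast
  define m where "m = min 1 b"
  define K where "K = max 1 (norm A)"
  have m: "0 < m" "m \<le> 1" using b by (auto simp: m_def)
  have K: "1 \<le> K" by (simp add: K_def)
  have "op_powr A s \<le>\<^sub>L (K / m) *\<^sub>R op_powr B s" if s: "0 \<le> s" "s \<le> 1" for s
  proof -
    have "op_powr A s \<le>\<^sub>L K *\<^sub>R id_blinfun"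
    proof (rule op_powr_le_spectrum[OF A])
      fix x assume x: "x \<in> op_spectrum A"
      then have "0 < x" "x \<le> K"
        using pos_def_spectrum_pos[OF A x] op_spectrum_bounded[OF pos_def_sym[OF A] x]
        by (auto simp: K_def)
      then have "x powr s \<le> K powr s" using s by (intro powr_mono2) auto
      also have "\<dots> \<le> K powr 1" using s K by (intro powr_mono) auto
      finally show "x powr s \<le> K" using K by simp
    qed
    moreover have "m *\<^sub>R id_blinfun \<le>\<^sub>L op_powr B s"
    proof (rule op_powr_ge_spectrum[OF B])
      fix x assume x: "x \<in> op_spectrum B"
      have "m \<le> x" using op_spectrum_ge[OF b(2) x] by (simp add: m_def)
      have "m powr 1 \<le> m powr s" using s m by (intro powr_mono') auto
      also have "\<dots> \<le> x powr s" using s m \<open>m \<le> x\<close> by (intro powr_mono2) auto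
      finally show "m \<le> x powr s" using m by simp
    qed
    then have "(K / m) *\<^sub>R (m *\<^sub>R id_blinfun) \<le>\<^sub>L (K / m) *\<^sub>R op_powr B s"
      using m K by (intro loewner_le_scaleR) auto
    then have "K *\<^sub>R id_blinfun \<le>\<^sub>L (K / m) *\<^sub>R op_powr B s" using m by simp
    ultimately show ?thesis by (rule loewner_le_trans)
  qed
  moreover have "1 \<le> K / m" using m K by (simp add: field_simps)
  ultimately show thesis using that by blast
qed

text \<open>
  The constant is \<open>1\<close> at \<open>s = 0\<close> and at \<open>s = 1\<close>, and every \<open>s\<close> in between is the midpoint of one of
  these two and another point of the interval. So by \<open>op_powr_le_midpoint\<close> a constant \<open>M\<close> valid on
  the whole interval improves to its square root; iterating, the constants tend to \<open>1\<close>.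
\<close>

theorem loewner_heinz:
  assumes A: "pos_def A" and B: "pos_def B" and AB: "A \<le>\<^sub>L B" and s: "0 \<le> s" "s \<le> 1"
  shows "op_powr A s \<le>\<^sub>L op_powr B s"
proof -
  obtain M where M: "1 \<le> M" "\<And>s. 0 \<le> s \<Longrightarrow> s \<le> 1 \<Longrightarrow> op_powr A s \<le>\<^sub>L M *\<^sub>R op_powr B s"
    using powr_loewner_bound[OF A B] by blast
  have bound: "op_powr A s \<le>\<^sub>L (M powr (1 / 2 ^ k)) *\<^sub>R op_powr B s" if "0 \<le> s" "s \<le> 1" for k s
    using that
  proof (induction k arbitrary: s)
    case 0
    then show ?case using M by simp
  next
    case (Suc k)
    have sqrt: "sqrt (M powr (1 / 2 ^ k) * 1) = M powr (1 / 2 ^ Suc k)"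
      using M(1) by (simp add: powr_half_sqrt[symmetric] powr_powr mult.commute)
    show ?case
    proof (cases "s \<le> 1/2")
      case True
      have "op_powr A ((2 * s + 0)/2) \<le>\<^sub>L sqrt (M powr (1 / 2 ^ k) * 1) *\<^sub>R op_powr B ((2 * s + 0)/2)"
        by (rule op_powr_le_midpoint[OF A B])
          (use True Suc in \<open>simp_all add: op_powr_0 A B\<close>)
      then show ?thesis unfolding sqrt by simp
    next
      case False
      have "op_powr A (((2 * s - 1) + 1)/2) \<le>\<^sub>L
          sqrt (M powr (1 / 2 ^ k) * 1) *\<^sub>R op_powr B (((2 * s - 1) + 1)/2)"
        by (rule op_powr_le_midpoint[OF A B])
          (use False Suc in \<open>simp_all add: op_powr_1 A B AB\<close>)
      then show ?thesis unfolding sqrt by simp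
    qed
  qed
  show ?thesis
  proof (rule loewner_le_scaleR_limit[OF bound[OF s]])
    have "(\<lambda>k. (1/2::real) ^ k) \<longlonglongrightarrow> 0" by (rule LIMSEQ_realpow_zero) auto
    then have "(\<lambda>k. M powr (1 / 2 ^ k)) \<longlonglongrightarrow> M powr 0"
      using M(1) by (intro tendsto_powr tendsto_const) (auto simp: power_one_over)
    then show "(\<lambda>k. M powr (1 / 2 ^ k)) \<longlonglongrightarrow> 1" using M(1) by simp
  qed (simp_all add: hermitian_op_powr A B)
qed

section \<open>The near-order and powers\<close>

lemma op_powr_square_root: "pos_def T \<Longrightarrow> op_powr (T o\<^sub>L T) (1/2) = T"
  using op_powr_compose[of T 1 1] op_powr_powr[of T 2 "1/2"] by (simp add: op_powr_1)

lemma op_powr_half_square: "pos_def T \<Longrightarrow> op_powr T (1/2) o\<^sub>L op_powr T (1/2) = T"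
  by (simp add: op_powr_compose op_powr_1)

lemma pos_def_square: "pos_def T \<Longrightarrow> pos_def (T o\<^sub>L T)"
  using pos_def_sandwich[of id_blinfun T] by simp

lemma loewner_le_square_root:
  assumes "pos_def S" "pos_def T" "S o\<^sub>L S \<le>\<^sub>L T"
  shows "S \<le>\<^sub>L op_powr T (1/2)"
  using loewner_heinz[OF pos_def_square[OF assms(1)] assms(2,3), of "1/2"]
  by (simp add: op_powr_square_root assms)

text \<open>
  Sandwiching between two copies of \<open>A\<^bsup>1/2\<^esup>\<close> turns the geometric mean of \<open>A\<^bsup>-1\<^esup>\<close> and \<open>B\<close> into the
  square root on the right and the identity into \<open>A\<close>.
\<close>

lemma near_le_iff:
  assumes A: "pos_def A" and B: "pos_def B"
  shows "A \<preceq>\<^sub>N B \<longleftrightarrow>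
    A \<le>\<^sub>L op_powr (op_powr A (1/2) o\<^sub>L B o\<^sub>L op_powr A (1/2)) (1/2)"
proof -
  define K where "K = op_powr (op_powr A (1/2) o\<^sub>L B o\<^sub>L op_powr A (1/2)) (1/2)"
  have geo: "geo_mean (op_inv A) B = op_powr A (-(1/2)) o\<^sub>L K o\<^sub>L op_powr A (-(1/2))"
    by (simp add: geo_mean_def op_inv_eq_powr A op_powr_powr K_def)
  have A_eq: "op_powr A (1/2) o\<^sub>L id_blinfun o\<^sub>L op_powr A (1/2) = A"
    by (simp add: op_powr_half_square A)
  have id_eq: "op_powr A (-(1/2)) o\<^sub>L A o\<^sub>L op_powr A (-(1/2)) = id_blinfun"
  proof -
    have "op_powr A (-(1/2)) o\<^sub>L op_powr A 1 o\<^sub>L op_powr A (-(1/2)) = id_blinfun"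
      by (simp add: op_powr_compose op_powr_0 A)
    then show ?thesis by (simp add: op_powr_1 A)
  qed
  show ?thesis
    unfolding near_le_def geo K_def[symmetric]
  proof
    assume "id_blinfun \<le>\<^sub>L op_powr A (-(1/2)) o\<^sub>L K o\<^sub>L op_powr A (-(1/2))"
    from loewner_le_sandwich[OF this hermitian_op_powr[OF A, of "1/2"]]
    show "A \<le>\<^sub>L K" unfolding A_eq op_powr_cancel_sandwich[OF A] .
  next
    assume "A \<le>\<^sub>L K"
    from loewner_le_sandwich[OF this hermitian_op_powr[OF A, of "-(1/2)"]]
    show "id_blinfun \<le>\<^sub>L op_powr A (-(1/2)) o\<^sub>L K o\<^sub>L op_powr A (-(1/2))" unfolding id_eq .
  qed
qed

text \<open>
  \<open>A\<^sup>2 = A\<^bsup>1/2\<^esup> A A\<^bsup>1/2\<^esup> \<le> A\<^bsup>1/2\<^esup> B A\<^bsup>1/2\<^esup>\<close>, and the square root is monotone.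
\<close>

lemma near_le_if_loewner_le:
  assumes A: "pos_def A" and B: "pos_def B" and "A \<le>\<^sub>L B"
  shows "A \<preceq>\<^sub>N B"
  unfolding near_le_iff[OF A B]
proof (rule loewner_le_square_root[OF A pos_def_sandwich[OF B pos_def_op_powr[OF A]]])
  have "A o\<^sub>L A = op_powr A (1/2) o\<^sub>L A o\<^sub>L op_powr A (1/2)"
    using op_powr_compose[OF A, of 1 1] op_powr_compose[OF A, of "1/2" 1]
      op_powr_compose[OF A, of "3/2" "1/2"] by (simp add: op_powr_1 A)
  then show "A o\<^sub>L A \<le>\<^sub>L op_powr A (1/2) o\<^sub>L B o\<^sub>L op_powr A (1/2)"
    using loewner_le_sandwich[OF assms(3) hermitian_op_powr[OF A]] by simp
qed

text \<open>
  \<open>K = A\<^bsup>-1/2\<^esup> C A\<^bsup>-1/2\<^esup>\<close> dominates the identity, so \<open>K \<le> K\<^sup>2\<close>; sandwiching with \<open>A\<^bsup>1/2\<^esup>\<close> gives the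
  claim.
\<close>

lemma loewner_le_inverse_sandwich:
  assumes A: "pos_def A" and C: "hermitian_op C" and AC: "A \<le>\<^sub>L C"
  shows "C \<le>\<^sub>L C o\<^sub>L op_powr A (-1) o\<^sub>L C"
proof -
  define P where "P = op_powr A (-(1/2))"
  define Q where "Q = op_powr A (1/2)"
  define K where "K = P o\<^sub>L C o\<^sub>L P"
  have P: "hermitian_op P" and Q: "hermitian_op Q"
    by (simp_all add: P_def Q_def hermitian_op_powr A)
  have PQ: "P o\<^sub>L Q = id_blinfun" "Q o\<^sub>L P = id_blinfun" and PP: "P o\<^sub>L P = op_powr A (-1)"
    and QQ: "Q o\<^sub>L Q = A"
    by (simp_all add: P_def Q_def op_powr_compose op_powr_0 op_powr_1 A)
  have PAP: "P o\<^sub>L A o\<^sub>L P = id_blinfun"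
  proof -
    have "P o\<^sub>L A o\<^sub>L P = (P o\<^sub>L Q) o\<^sub>L (Q o\<^sub>L P)"
      by (simp only: blinfun_compose_assoc flip: QQ)
    then show ?thesis by (simp add: PQ)
  qed
  have I: "id_blinfun \<le>\<^sub>L K"
    using loewner_le_sandwich[OF AC P] by (simp add: K_def PAP)
  have K: "pos_def K"
    by (rule pos_def_mono[OF pos_def_id I]) (simp add: K_def hermitian_op_sandwich P C)
  have "K \<le>\<^sub>L op_powr K (1/2) o\<^sub>L K o\<^sub>L op_powr K (1/2)"
    using loewner_le_sandwich[OF I hermitian_op_powr[OF K, of "1/2"]]
    by (simp add: op_powr_half_square K)
  also have "op_powr K (1/2) o\<^sub>L K o\<^sub>L op_powr K (1/2) = K o\<^sub>L K"
    using op_powr_compose[OF K, of 1 1] op_powr_compose[OF K, of "1/2" 1]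
      op_powr_compose[OF K, of "3/2" "1/2"] by (simp add: op_powr_1 K)
  finally have "Q o\<^sub>L K o\<^sub>L Q \<le>\<^sub>L Q o\<^sub>L (K o\<^sub>L K) o\<^sub>L Q"
    by (rule loewner_le_sandwich[OF _ Q])
  also have "Q o\<^sub>L K o\<^sub>L Q = C"
  proof -
    have "Q o\<^sub>L K o\<^sub>L Q = (Q o\<^sub>L P) o\<^sub>L C o\<^sub>L (P o\<^sub>L Q)"
      by (simp only: K_def blinfun_compose_assoc)
    then show ?thesis by (simp add: PQ)
  qed
  also have "Q o\<^sub>L (K o\<^sub>L K) o\<^sub>L Q = C o\<^sub>L op_powr A (-1) o\<^sub>L C"
  proof -
    have "Q o\<^sub>L (K o\<^sub>L K) o\<^sub>L Q = (Q o\<^sub>L P) o\<^sub>L C o\<^sub>L (P o\<^sub>L P) o\<^sub>L C o\<^sub>L (P o\<^sub>L Q)"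
      by (simp only: K_def blinfun_compose_assoc)
    then show ?thesis by (simp add: PQ PP)
  qed
  finally show ?thesis .
qed

text \<open>
  With \<open>Z = P C\<close> and its adjoint \<open>Z\<^sup>* = C P\<close> this is \<open>(Z Z\<^sup>*)\<^bsup>1+s\<^esup> = Z (Z\<^sup>* Z)\<^bsup>s\<^esup> Z\<^sup>*\<close>.
\<close>

lemma powr_sandwich_swap:
  assumes C: "pos_def C" and P: "pos_def P"
  shows "op_powr (P o\<^sub>L (C o\<^sub>L C) o\<^sub>L P) (1 + s) =
    P o\<^sub>L C o\<^sub>L op_powr (C o\<^sub>L (P o\<^sub>L P) o\<^sub>L C) s o\<^sub>L C o\<^sub>L P"
proof -
  define S where "S = P o\<^sub>L (C o\<^sub>L C) o\<^sub>L P"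
  define T where "T = C o\<^sub>L (P o\<^sub>L P) o\<^sub>L C"
  have S: "pos_def S" and T: "pos_def T"
    by (simp_all only: S_def T_def pos_def_sandwich pos_def_square C P)
  have cont: "continuous_on (op_spectrum S \<union> op_spectrum T) (\<lambda>x. x powr s)"
    by (intro continuous_intros) (use pos_def_spectrum_pos[OF S] pos_def_spectrum_pos[OF T] in force)
  have "S o\<^sub>L (P o\<^sub>L C) = (P o\<^sub>L C) o\<^sub>L T"
    by (simp add: S_def T_def blinfun_compose_assoc)
  from op_fun_intertwine[OF pos_def_sym[OF S] pos_def_sym[OF T] cont this]
  have swap: "op_powr S s o\<^sub>L (P o\<^sub>L C) = (P o\<^sub>L C) o\<^sub>L op_powr T s"
    by (simp add: op_powr_def)
  have "op_powr S (1 + s) = op_powr S s o\<^sub>L S"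
    using op_powr_compose[OF S, of s 1] by (simp add: op_powr_1 S add.commute)
  also have "\<dots> = (op_powr S s o\<^sub>L (P o\<^sub>L C)) o\<^sub>L C o\<^sub>L P"
    by (simp add: S_def blinfun_compose_assoc)
  finally show ?thesis
    unfolding swap by (simp only: S_def T_def)
qed

text \<open>
  An inequality of Ando--Hiai type. Let \<open>C\<close> be the square root of \<open>A\<^bsup>1/2\<^esup> B A\<^bsup>1/2\<^esup>\<close>, so that the
  hypothesis is \<open>A \<le> C\<close> and \<open>B = A\<^bsup>-1/2\<^esup> C\<^sup>2 A\<^bsup>-1/2\<^esup>\<close>. Then
  \<open>B\<^bsup>r\<^esup> = A\<^bsup>-1/2\<^esup> C (C A\<^bsup>-1\<^esup> C)\<^bsup>r-1\<^esup> C A\<^bsup>-1/2\<^esup> \<ge> A\<^bsup>-1/2\<^esup> C\<^bsup>r+1\<^esup> A\<^bsup>-1/2\<^esup>\<close>, because \<open>C A\<^bsup>-1\<^esup> C \<ge> C\<close> and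
  \<open>0 \<le> r - 1 \<le> 1\<close>. With \<open>D = A\<^bsup>(r-1)/2\<^esup>\<close> this bounds \<open>A\<^bsup>r/2\<^esup> B\<^bsup>r\<^esup> A\<^bsup>r/2\<^esup>\<close> below by \<open>D C\<^bsup>r+1\<^esup> D\<close>,
  which in turn is at least \<open>D C D\<^sup>2 C D = (D C D)\<^sup>2\<close>, as \<open>D\<^sup>2 = A\<^bsup>r-1\<^esup> \<le> C\<^bsup>r-1\<^esup>\<close>. Taking square
  roots leaves \<open>D C D \<ge> D A D = A\<^bsup>r\<^esup>\<close>.
\<close>

lemma near_le_powr_step:
  assumes A: "pos_def A" and B: "pos_def B" and near: "A \<preceq>\<^sub>N B" and r: "1 \<le> r" "r \<le> 2"
  shows "op_powr A r \<preceq>\<^sub>N op_powr B r"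
proof -
  define P where "P = op_powr A (-(1/2))"
  define C where "C = op_powr (op_powr A (1/2) o\<^sub>L B o\<^sub>L op_powr A (1/2)) (1/2)"
  define D where "D = op_powr A ((r - 1)/2)"
  have P: "pos_def P" and D: "pos_def D" by (simp_all add: P_def D_def pos_def_op_powr A)
  have ABA: "pos_def (op_powr A (1/2) o\<^sub>L B o\<^sub>L op_powr A (1/2))"
    by (intro pos_def_sandwich pos_def_op_powr A B)
  have C: "pos_def C" unfolding C_def by (intro pos_def_op_powr ABA)
  have AC: "A \<le>\<^sub>L C" using near unfolding near_le_iff[OF A B] C_def .
  have CC: "C o\<^sub>L C = op_powr A (1/2) o\<^sub>L B o\<^sub>L op_powr A (1/2)"
    unfolding C_def by (rule op_powr_half_square[OF ABA])
  have B_eq: "P o\<^sub>L (C o\<^sub>L C) o\<^sub>L P = B"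
    unfolding CC P_def using op_powr_cancel_sandwich[OF A, of "-(1/2)" B] by simp
  have PP: "P o\<^sub>L P = op_powr A (-1)" by (simp add: P_def op_powr_compose A)
  define T where "T = C o\<^sub>L (P o\<^sub>L P) o\<^sub>L C"
  have T: "pos_def T" unfolding T_def by (intro pos_def_sandwich pos_def_square P C)
  have CT: "C \<le>\<^sub>L T"
    unfolding T_def PP by (rule loewner_le_inverse_sandwich[OF A pos_def_hermitian[OF C] AC])
  have "op_powr C (r - 1) \<le>\<^sub>L op_powr T (r - 1)"
    by (rule loewner_heinz[OF C T CT]) (use r in auto)
  then have "P o\<^sub>L (C o\<^sub>L op_powr C (r - 1) o\<^sub>L C) o\<^sub>L P \<le>\<^sub>L P o\<^sub>L (C o\<^sub>L op_powr T (r - 1) o\<^sub>L C) o\<^sub>L P"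
    by (intro loewner_le_sandwich pos_def_hermitian C P)
  also have "P o\<^sub>L (C o\<^sub>L op_powr T (r - 1) o\<^sub>L C) o\<^sub>L P = op_powr B r"
    using powr_sandwich_swap[OF C P, of "r - 1"]
    unfolding B_eq T_def[symmetric] by (simp add: blinfun_compose_assoc)
  finally have "op_powr A (r/2) o\<^sub>L (P o\<^sub>L (C o\<^sub>L op_powr C (r - 1) o\<^sub>L C) o\<^sub>L P) o\<^sub>L op_powr A (r/2)
      \<le>\<^sub>L op_powr A (r/2) o\<^sub>L op_powr B r o\<^sub>L op_powr A (r/2)"
    by (rule loewner_le_sandwich[OF _ hermitian_op_powr[OF A]])
  also have "op_powr A (r/2) o\<^sub>L (P o\<^sub>L (C o\<^sub>L op_powr C (r - 1) o\<^sub>L C) o\<^sub>L P) o\<^sub>L op_powr A (r/2)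
      = D o\<^sub>L (C o\<^sub>L op_powr C (r - 1) o\<^sub>L C) o\<^sub>L D"
  proof -
    have "op_powr A (r/2) o\<^sub>L P = D" "P o\<^sub>L op_powr A (r/2) = D"
      by (simp_all add: P_def D_def op_powr_compose A diff_divide_distrib)
    moreover have "op_powr A (r/2) o\<^sub>L (P o\<^sub>L X o\<^sub>L P) o\<^sub>L op_powr A (r/2)
        = (op_powr A (r/2) o\<^sub>L P) o\<^sub>L X o\<^sub>L (P o\<^sub>L op_powr A (r/2))" for X
      by (simp only: blinfun_compose_assoc)
    ultimately show ?thesis by simp
  qed
  finally have lower: "D o\<^sub>L (C o\<^sub>L op_powr C (r - 1) o\<^sub>L C) o\<^sub>L D
      \<le>\<^sub>L op_powr A (r/2) o\<^sub>L op_powr B r o\<^sub>L op_powr A (r/2)" .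
  have "op_powr A (r - 1) \<le>\<^sub>L op_powr C (r - 1)"
    by (rule loewner_heinz[OF A C AC]) (use r in auto)
  then have "D o\<^sub>L (C o\<^sub>L op_powr A (r - 1) o\<^sub>L C) o\<^sub>L D \<le>\<^sub>L D o\<^sub>L (C o\<^sub>L op_powr C (r - 1) o\<^sub>L C) o\<^sub>L D"
    by (intro loewner_le_sandwich pos_def_hermitian C D)
  also have "D o\<^sub>L (C o\<^sub>L op_powr A (r - 1) o\<^sub>L C) o\<^sub>L D = (D o\<^sub>L C o\<^sub>L D) o\<^sub>L (D o\<^sub>L C o\<^sub>L D)"
  proof -
    have "op_powr A (r - 1) = D o\<^sub>L D" by (simp add: D_def op_powr_compose A)
    then show ?thesis by (simp only: blinfun_compose_assoc)
  qed
  also note lower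
  finally have "D o\<^sub>L C o\<^sub>L D \<le>\<^sub>L op_powr (op_powr A (r/2) o\<^sub>L op_powr B r o\<^sub>L op_powr A (r/2)) (1/2)"
    by (intro loewner_le_square_root pos_def_sandwich pos_def_op_powr A B C D)
  moreover have "op_powr A r \<le>\<^sub>L D o\<^sub>L C o\<^sub>L D"
  proof -
    have "D o\<^sub>L op_powr A 1 o\<^sub>L D = op_powr A r"
      by (simp add: D_def op_powr_compose A field_simps)
    then show ?thesis
      using loewner_le_sandwich[OF AC pos_def_hermitian[OF D]] by (simp add: op_powr_1 A)
  qed
  ultimately have "op_powr A r \<le>\<^sub>L op_powr (op_powr A (r/2) o\<^sub>L op_powr B r o\<^sub>L op_powr A (r/2)) (1/2)"
    by (rule loewner_le_trans[rotated])
  then show ?thesis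
    by (simp add: near_le_iff pos_def_op_powr A B op_powr_powr)
qed

text \<open>
  Exponents up to \<open>2\<close> are covered by \<open>near_le_powr_step\<close>, larger ones by repeated doubling.
\<close>

theorem near_le_powr:
  assumes A: "pos_def A" and B: "pos_def B" and near: "A \<preceq>\<^sub>N B" and "1 \<le> r"
  shows "op_powr A r \<preceq>\<^sub>N op_powr B r"
proof -
  have bounded: "op_powr A r \<preceq>\<^sub>N op_powr B r" if "1 \<le> r" "r \<le> 2 ^ k" for k r
    using that
  proof (induction k arbitrary: r)
    case 0
    then have "r = 1" by simp
    then show ?case using near by (simp add: op_powr_1 A B)
  next
    case (Suc k)
    show ?case
    proof (cases "r \<le> 2")
      case True
      then show ?thesis using near_le_powr_step[OF A B near] Suc.prems by simp
    next
      case False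
      then have "op_powr A (r/2) \<preceq>\<^sub>N op_powr B (r/2)" using Suc by simp
      then have "op_powr (op_powr A (r/2)) 2 \<preceq>\<^sub>N op_powr (op_powr B (r/2)) 2"
        using near_le_powr_step[OF pos_def_op_powr[OF A] pos_def_op_powr[OF B], of "r/2" "r/2" 2]
        by simp
      then show ?thesis by (simp add: op_powr_powr A B)
    qed
  qed
  obtain k :: nat where "r < 2 ^ k" using real_arch_pow[of 2 r] by auto
  then show ?thesis using bounded[OF \<open>1 \<le> r\<close>, of k] by simp
qed

section \<open>Fixed points of monotone homogeneous maps\<close>

lemma pos_def_dominated:
  assumes "pos_def X" "pos_def Y"
  obtains c where "1 \<le> c" "X \<le>\<^sub>L c *\<^sub>R Y"
proof -
  obtain c where c: "1 \<le> c" "\<And>s. 0 \<le> s \<Longrightarrow> s \<le> 1 \<Longrightarrow> op_powr X s \<le>\<^sub>L c *\<^sub>R op_powr Y s"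
    using powr_loewner_bound[OF assms] by blast
  then show thesis using that[of c] c(2)[of 1] by (simp add: op_powr_1 assms)
qed

text \<open>
  Such a map contracts the Thompson metric, the logarithm of the least \<open>c \<ge> 1\<close> with
  \<open>X \<le> c Y\<close> and \<open>Y \<le> c X\<close>, by the factor \<open>t\<close>; the lemma \<open>contract\<close> is the one-sided form of this.
  Uniqueness and existence of a positive definite fixed point follow as in Banach's fixed
  point theorem, with convergence read off in the operator norm.
\<close>

locale monotone_homogeneous_map =
  fixes F :: "'a::complex_hilbert op \<Rightarrow> 'a op" and t :: real
  assumes t: "0 \<le> t" "t < 1"
    and pos: "pos_def X \<Longrightarrow> pos_def (F X)"
    and mono: "pos_def X \<Longrightarrow> pos_def Y \<Longrightarrow> X \<le>\<^sub>L Y \<Longrightarrow> F X \<le>\<^sub>L F Y"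
    and hom: "pos_def X \<Longrightarrow> 0 < c \<Longrightarrow> F (c *\<^sub>R X) = (c powr t) *\<^sub>R F X"
begin

lemma pos_iterate: "pos_def X \<Longrightarrow> pos_def ((F ^^ k) X)"
  by (induction k) (simp_all add: pos)

lemma contract:
  assumes "pos_def X" "pos_def Y" "0 < c" "X \<le>\<^sub>L c *\<^sub>R Y"
  shows "F X \<le>\<^sub>L (c powr t) *\<^sub>R F Y"
  using mono[OF assms(1) pos_def_scaleR[OF assms(2,3)] assms(4)] by (simp add: hom assms)

lemma contract_iterate:
  assumes "pos_def X" "pos_def Y" "0 < c" "X \<le>\<^sub>L c *\<^sub>R Y"
  shows "(F ^^ k) X \<le>\<^sub>L (c powr (t ^ k)) *\<^sub>R (F ^^ k) Y"
proof (induction k)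
  case 0
  then show ?case using assms by simp
next
  case (Suc k)
  then show ?case
    using contract[OF pos_iterate[OF assms(1)] pos_iterate[OF assms(2)] _ Suc.IH] \<open>0 < c\<close>
    by (simp add: powr_powr mult.commute)
qed

lemma powr_iterate_tendsto: "0 < c \<Longrightarrow> (\<lambda>k. c powr (t ^ k)) \<longlonglongrightarrow> 1"
proof -
  assume "0 < c"
  have "(\<lambda>k. t ^ k) \<longlonglongrightarrow> 0" using t by (intro LIMSEQ_realpow_zero) auto
  then have "(\<lambda>k. c powr (t ^ k)) \<longlonglongrightarrow> c powr 0"
    using \<open>0 < c\<close> by (intro tendsto_powr tendsto_const) auto
  then show ?thesis using \<open>0 < c\<close> by simp
qed

text \<open>
  Iterating the map fixes both sides and improves the constant \<open>c\<close> in \<open>X \<le> c Y\<close> to \<open>c\<close> to the power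
  \<open>t ^ k\<close>, which tends to \<open>1\<close>.
\<close>

lemma fixpoint_le:
  assumes X: "pos_def X" "X = F X" and Y: "pos_def Y" "Y = F Y"
  shows "X \<le>\<^sub>L Y"
proof -
  obtain c where c: "1 \<le> c" "X \<le>\<^sub>L c *\<^sub>R Y"
    using pos_def_dominated[OF X(1) Y(1)] by blast
  have iter: "(F ^^ k) X = X" "(F ^^ k) Y = Y" for k
    by (induction k) (simp_all flip: X(2) Y(2))
  have "X \<le>\<^sub>L (c powr (t ^ k)) *\<^sub>R Y" for k
    using contract_iterate[OF X(1) Y(1) _ c(2), of k] c(1) by (simp add: iter)
  then show ?thesis
    by (rule loewner_le_scaleR_limit)
      (use c(1) X Y in \<open>auto intro!: powr_iterate_tendsto pos_def_hermitian\<close>)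
qed

definition iter :: "nat \<Rightarrow> 'a op"
  where "iter k = (F ^^ k) id_blinfun"

lemma pos_def_iter: "pos_def (iter k)"
  by (simp add: iter_def pos_iterate)

lemma iter_Suc: "iter (Suc k) = F (iter k)"
  by (simp add: iter_def)

lemma iter_step:
  obtains c where "1 \<le> c"
    "\<And>k. iter (Suc k) \<le>\<^sub>L (c powr (t ^ k)) *\<^sub>R iter k"
    "\<And>k. iter k \<le>\<^sub>L (c powr (t ^ k)) *\<^sub>R iter (Suc k)"
proof -
  note F1 = pos[OF pos_def_id]
  obtain a b where a: "1 \<le> a" "F id_blinfun \<le>\<^sub>L a *\<^sub>R id_blinfun"
    and b: "1 \<le> b" "id_blinfun \<le>\<^sub>L b *\<^sub>R F id_blinfun"
    using pos_def_dominated[OF F1 pos_def_id] pos_def_dominated[OF pos_def_id F1] by metis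
  define c where "c = max a b"
  have weaken: "X \<le>\<^sub>L c *\<^sub>R Y" if "X \<le>\<^sub>L d *\<^sub>R Y" "d \<le> c" "pos_def Y"
    for X Y :: "'a op" and d
    using that loewner_le_trans loewner_le_scaleR_left by (meson pos_def_def)
  have "0 < c" "1 \<le> c" using a(1) by (auto simp: c_def)
  have "F id_blinfun \<le>\<^sub>L c *\<^sub>R id_blinfun" "id_blinfun \<le>\<^sub>L c *\<^sub>R F id_blinfun"
    using weaken[OF a(2)] weaken[OF b(2)] F1 by (auto simp: c_def)
  from contract_iterate[OF F1 pos_def_id \<open>0 < c\<close> this(1)]
    contract_iterate[OF pos_def_id F1 \<open>0 < c\<close> this(2)]
  show thesis
    using that[OF \<open>1 \<le> c\<close>] by (simp add: iter_def funpow_swap1)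
qed

text \<open>
  An interval from \<open>K\<^bsup>-1\<^esup> I\<close> to \<open>K I\<close> is mapped into itself when \<open>K\<^bsup>t\<^esup> c = K\<close>, where \<open>c\<close> compares the
  identity with its image; this determines \<open>K\<close>.
\<close>

lemma iter_bounded:
  obtains K where "1 \<le> K" "\<And>k. iter k \<le>\<^sub>L K *\<^sub>R id_blinfun" "\<And>k. id_blinfun \<le>\<^sub>L K *\<^sub>R iter k"
proof -
  obtain c where "1 \<le> c"
    and step: "\<And>k. iter (Suc k) \<le>\<^sub>L (c powr (t ^ k)) *\<^sub>R iter k"
      "\<And>k. iter k \<le>\<^sub>L (c powr (t ^ k)) *\<^sub>R iter (Suc k)"
    by (rule iter_step) (rule that)
  then have c: "1 \<le> c" "iter 1 \<le>\<^sub>L c *\<^sub>R id_blinfun" "id_blinfun \<le>\<^sub>L c *\<^sub>R iter 1"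
    using step(1)[of 0] step(2)[of 0] by (simp_all add: iter_def)
  define K where "K = c powr (1 / (1 - t))"
  have K: "1 \<le> K" using c t by (simp add: K_def ge_one_powr_ge_zero)
  have "K powr t * c = K powr t * K powr (1 - t)"
    using c t by (simp add: K_def powr_powr)
  also have "\<dots> = K" using K by (simp flip: powr_add)
  finally have Ktc: "K powr t * c = K" .
  have "iter k \<le>\<^sub>L K *\<^sub>R id_blinfun \<and> id_blinfun \<le>\<^sub>L K *\<^sub>R iter k" for k
  proof (induction k)
    case 0
    have "1 *\<^sub>R id_blinfun \<le>\<^sub>L K *\<^sub>R (id_blinfun :: 'a op)"
      by (intro loewner_le_scaleR_left K) (use pos_def_id pos_def_def in blast)
    then show ?case by (simp add: iter_def)
  next
    case (Suc k)
    have "iter (Suc k) \<le>\<^sub>L (K powr t) *\<^sub>R iter 1"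
      using contract[OF pos_def_iter pos_def_id, of K k] Suc K by (simp add: iter_def)
    also have "(K powr t) *\<^sub>R iter 1 \<le>\<^sub>L (K powr t) *\<^sub>R (c *\<^sub>R id_blinfun)"
      by (intro loewner_le_scaleR c) simp
    finally have up: "iter (Suc k) \<le>\<^sub>L K *\<^sub>R id_blinfun" by (simp add: Ktc)
    have "iter 1 \<le>\<^sub>L (K powr t) *\<^sub>R iter (Suc k)"
      using contract[OF pos_def_id pos_def_iter, of K k] Suc K by (simp add: iter_def)
    then have "c *\<^sub>R iter 1 \<le>\<^sub>L c *\<^sub>R ((K powr t) *\<^sub>R iter (Suc k))"
      using c(1) by (intro loewner_le_scaleR) auto
    then have "c *\<^sub>R iter 1 \<le>\<^sub>L K *\<^sub>R iter (Suc k)" by (simp add: mult.commute[of c] Ktc)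
    with c(3) have "id_blinfun \<le>\<^sub>L K *\<^sub>R iter (Suc k)" by (rule loewner_le_trans)
    with up show ?case by simp
  qed
  then show thesis using that K by blast
qed

text \<open>
  Consecutive iterates agree up to the factor \<open>c\<close> to the power \<open>t ^ k\<close>, which exceeds \<open>1\<close> by at most
  a multiple of \<open>t ^ k\<close>. As the iterates are bounded, the norms of their differences are summable.
\<close>

lemma convergent_iter: "convergent iter"
proof -
  obtain c where c: "1 \<le> c"
    and up: "\<And>k. iter (Suc k) \<le>\<^sub>L (c powr (t ^ k)) *\<^sub>R iter k"
    and down: "\<And>k. iter k \<le>\<^sub>L (c powr (t ^ k)) *\<^sub>R iter (Suc k)"
    by (rule iter_step) (rule that)
  obtain K where K: "1 \<le> K" and bound: "\<And>k. iter k \<le>\<^sub>L K *\<^sub>R id_blinfun"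
    and "\<And>k. id_blinfun \<le>\<^sub>L K *\<^sub>R iter k"
    by (rule iter_bounded) (rule that)
  have step: "norm (iter (Suc k) - iter k) \<le> (ln c * c * K) * t ^ k" for k
  proof -
    define y where "y = c powr (t ^ k)"
    have tk: "0 \<le> t ^ k" "t ^ k \<le> 1" using t by (auto simp: power_le_one)
    have y1: "1 \<le> y" using c tk by (simp add: y_def ge_one_powr_ge_zero)
    have "y \<le> c powr 1" unfolding y_def using c tk by (intro powr_mono) auto
    then have "y \<le> c" using c by simp
    \<comment> \<open>The inequality \<open>1 + u \<le> exp u\<close> at \<open>u = - ln y\<close> gives the bound on \<open>y - 1\<close> that
      is linear in \<open>t ^ k\<close>.\<close>
    have "1 - ln y \<le> 1 / y"
      using exp_ge_add_one_self[of "- ln y"] y1 by (simp add: exp_minus inverse_eq_divide)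
    then have "y - 1 \<le> ln y * y" using y1 by (simp add: field_simps)
    also have "\<dots> \<le> ln y * c" using \<open>y \<le> c\<close> y1 by (intro mult_left_mono) auto
    also have "ln y = t ^ k * ln c" using c by (simp add: y_def ln_powr)
    finally have y2: "y - 1 \<le> t ^ k * ln c * c" .
    have "norm (iter (Suc k) - iter k) \<le> (y - 1) * K"
    proof (rule norm_sym_op_le)
      show "sym_op (iter (Suc k) - iter k)" by (intro sym_op_diff pos_def_sym pos_def_iter)
      show "0 \<le> (y - 1) * K" using y1 K by simp
      fix v
      define p q where "p = inner v (iter k v)" and "q = inner v (iter (Suc k) v)"
      have pq: "q \<le> y * p" "p \<le> y * q" "p \<le> K * (norm v)\<^sup>2" "q \<le> K * (norm v)\<^sup>2"
        using loewner_leD[OF up[of k], of v] loewner_leD[OF down[of k], of v]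
          loewner_leD[OF bound[of k], of v] loewner_leD[OF bound[of "Suc k"], of v]
        by (simp_all add: p_def q_def y_def blinfun.scaleR_left power2_norm_eq_inner)
      have "(y - 1) * p \<le> (y - 1) * (K * (norm v)\<^sup>2)" "(y - 1) * q \<le> (y - 1) * (K * (norm v)\<^sup>2)"
        using y1 pq by (auto intro: mult_left_mono)
      then have "\<bar>q - p\<bar> \<le> (y - 1) * (K * (norm v)\<^sup>2)"
        using pq(1,2) by (simp add: abs_le_iff algebra_simps)
      then show "\<bar>inner v ((iter (Suc k) - iter k) v)\<bar> \<le> (y - 1) * K * (norm v)\<^sup>2"
        by (simp add: p_def q_def blinfun.diff_left inner_diff_right mult.assoc)
    qed
    also have "\<dots> \<le> (t ^ k * ln c * c) * K"
      using y2 K by (intro mult_right_mono) auto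
    finally show ?thesis by (simp add: algebra_simps)
  qed
  have "summable (\<lambda>k. (ln c * c * K) * t ^ k)"
    using t by (intro summable_mult summable_geometric) auto
  then have "summable (\<lambda>k. iter (Suc k) - iter k)"
    by (rule summable_comparison_test') (rule step)
  then obtain S where "(\<lambda>n. \<Sum>k<n. iter (Suc k) - iter k) \<longlonglongrightarrow> S"
    using summable_LIMSEQ by blast
  then have "(\<lambda>n. (iter n - iter 0) + iter 0) \<longlonglongrightarrow> S + iter 0"
    unfolding sum_lessThan_telescope by (intro tendsto_add tendsto_const)
  then show ?thesis by (auto simp: convergent_def)
qed

text \<open>
  The iterates converge to some \<open>X\<close> in norm, and \<open>X\<close> and all iterates dominate the identity up to
  one constant \<open>K\<close>. So norm convergence implies two-sided comparisons between the \<open>k\<close>-th iterate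
  and \<open>X\<close> with a factor \<open>a k\<close> tending to \<open>1\<close>. Applying the map preserves them up to a power of
  the factor, and comparing \<open>X\<close> with its image through the next iterate gives equality.
\<close>

lemma fixpoint_exists: "\<exists>X. pos_def X \<and> X = F X"
proof -
  obtain X where X: "iter \<longlonglongrightarrow> X"
    using convergent_iter by (auto simp: convergent_def)
  obtain K where K: "1 \<le> K" and "\<And>k. iter k \<le>\<^sub>L K *\<^sub>R id_blinfun"
    and below: "\<And>k. id_blinfun \<le>\<^sub>L K *\<^sub>R iter k"
    by (rule iter_bounded) (rule that)
  have herm: "hermitian_op X"
    by (rule hermitian_op_limit[OF pos_def_hermitian[OF pos_def_iter] X])
  have below_iter: "(norm v)\<^sup>2 \<le> K * inner v (iter k v)" for v k
    using loewner_leD[OF below[of k], of v] by (simp add: blinfun.scaleR_left power2_norm_eq_inner)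
  have below_X: "(norm v)\<^sup>2 \<le> K * inner v (X v)" for v
  proof -
    have "(\<lambda>k. K * inner v (iter k v)) \<longlonglongrightarrow> K * inner v (X v)"
      by (intro tendsto_intros X)
    then show ?thesis using below_iter by (intro LIMSEQ_le_const) auto
  qed
  have pos_X: "pos_def X"
    by (rule pos_defI_coercive[OF herm, of "1 / K"])
      (use K below_X in \<open>auto simp: field_simps\<close>)
  define a where "a k = 1 + norm (iter k - X) * K" for k
  have a_pos: "0 < a k" for k using K by (simp add: a_def add_pos_nonneg)
  have "(\<lambda>k. norm (iter k - X)) \<longlonglongrightarrow> 0"
    using X by (simp add: LIM_zero_iff tendsto_norm_zero_iff)
  then have a_lim: "a \<longlonglongrightarrow> 1"
    unfolding a_def using tendsto_add[OF tendsto_const tendsto_mult_left_zero, of _ sequentially 1 K] by simp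
  have close: "\<bar>inner v ((iter k - X) v)\<bar> \<le> norm (iter k - X) * (norm v)\<^sup>2" for k v
  proof -
    have "\<bar>inner v ((iter k - X) v)\<bar> \<le> norm v * (norm (iter k - X) * norm v)"
      by (intro order.trans[OF Cauchy_Schwarz_ineq2] mult_left_mono norm_blinfun) simp
    then show ?thesis by (simp add: power2_eq_square algebra_simps)
  qed
  have up: "iter k \<le>\<^sub>L a k *\<^sub>R X" for k
  proof -
    have "inner v (iter k v) \<le> a k * inner v (X v)" for v
    proof -
      have "inner v ((iter k - X) v) \<le> norm (iter k - X) * (K * inner v (X v))"
        using close[of v k] mult_left_mono[OF below_X[of v], of "norm (iter k - X)"] by simp
      then show ?thesis
        by (simp add: a_def blinfun.diff_left inner_diff_right algebra_simps)
    qed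
    then show ?thesis
      by (simp add: loewner_le_iff hermitian_op_scaleR herm pos_def_hermitian[OF pos_def_iter]
          blinfun.scaleR_left)
  qed
  have down: "X \<le>\<^sub>L a k *\<^sub>R iter k" for k
  proof -
    have "inner v (X v) \<le> a k * inner v (iter k v)" for v
    proof -
      have "- inner v ((iter k - X) v) \<le> norm (iter k - X) * (K * inner v (iter k v))"
        using close[of v k] mult_left_mono[OF below_iter[of v k], of "norm (iter k - X)"] by simp
      then show ?thesis
        by (simp add: a_def blinfun.diff_left inner_diff_right algebra_simps)
    qed
    then show ?thesis
      by (simp add: loewner_le_iff hermitian_op_scaleR herm pos_def_hermitian[OF pos_def_iter]
          blinfun.scaleR_left)
  qed
  have lim: "(\<lambda>k. a (Suc k) * a k powr t) \<longlonglongrightarrow> 1"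
    using tendsto_mult[OF LIMSEQ_Suc[OF a_lim] tendsto_powr[OF a_lim tendsto_const, of t]] by simp
  have "X \<le>\<^sub>L (a (Suc k) * a k powr t) *\<^sub>R F X" for k
  proof -
    have "iter (Suc k) \<le>\<^sub>L (a k powr t) *\<^sub>R F X"
      unfolding iter_Suc by (rule contract[OF pos_def_iter pos_X a_pos up])
    then have "a (Suc k) *\<^sub>R iter (Suc k) \<le>\<^sub>L a (Suc k) *\<^sub>R ((a k powr t) *\<^sub>R F X)"
      using a_pos[of "Suc k"] by (intro loewner_le_scaleR) auto
    with down[of "Suc k"] show ?thesis by (simp add: loewner_le_trans)
  qed
  then have "X \<le>\<^sub>L F X"
    by (rule loewner_le_scaleR_limit[OF _ lim herm pos_def_hermitian[OF pos[OF pos_X]]])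
  have "F X \<le>\<^sub>L (a (Suc k) * a k powr t) *\<^sub>R X" for k
  proof -
    have "F X \<le>\<^sub>L (a k powr t) *\<^sub>R iter (Suc k)"
      unfolding iter_Suc by (rule contract[OF pos_X pos_def_iter a_pos down])
    moreover have "(a k powr t) *\<^sub>R iter (Suc k) \<le>\<^sub>L (a k powr t) *\<^sub>R (a (Suc k) *\<^sub>R X)"
      by (intro loewner_le_scaleR up) simp
    ultimately show ?thesis by (metis loewner_le_trans mult.commute scaleR_scaleR)
  qed
  then have "F X \<le>\<^sub>L X"
    by (rule loewner_le_scaleR_limit[OF _ lim pos_def_hermitian[OF pos[OF pos_X]] herm])
  with \<open>X \<le>\<^sub>L F X\<close> pos_X show ?thesis using loewner_le_antisym by blast
qed

theorem fixpoint_unique_exists: "\<exists>!X. pos_def X \<and> X = F X"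
  using fixpoint_exists fixpoint_le loewner_le_antisym by metis

end

section \<open>The Renyi power mean\<close>

lemma op_powr_id: "op_powr id_blinfun s = (id_blinfun :: 'a::complex_hilbert op)"
  using op_powr_powr[OF pos_def_id, of 0 s] by (simp add: op_powr_0)

definition renyi_map ::
    "real \<Rightarrow> real \<Rightarrow> nat \<Rightarrow> (nat \<Rightarrow> real) \<Rightarrow> (nat \<Rightarrow> 'a::complex_hilbert op) \<Rightarrow> 'a op \<Rightarrow> 'a op"
  where "renyi_map t z n w A X = (\<Sum>j=1..n. w j *\<^sub>R
      op_powr (op_powr (A j) ((1 - t) / (2 * z)) o\<^sub>L op_powr X (t / z)
               o\<^sub>L op_powr (A j) ((1 - t) / (2 * z))) z)"

text \<open>
  Monotonicity is the Loewner--Heinz inequality, once with exponent \<open>t / z\<close> and once with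
  exponent \<open>z\<close>; the degree of homogeneity is the product of the two exponents.
\<close>

lemma monotone_homogeneous_renyi_map:
  assumes A: "\<forall>j\<in>{1..n}. pos_def (A j)" and w: "prob_vector n w"
    and t: "0 \<le> t" "t < z" and z: "z \<le> 1"
  shows "monotone_homogeneous_map (renyi_map t z n w A) t"
proof
  show "0 \<le> t" "t < 1" using t z by auto
  have tz: "0 \<le> t / z" "t / z \<le> 1" using t by auto
  have n: "{1..n} \<noteq> {}" using w by (cases "n = 0") (auto simp: prob_vector_def)
  have w_pos: "0 < w j" if "j \<in> {1..n}" for j
    using w that by (simp add: prob_vector_def)
  have sandwich: "pos_def (op_powr (A j) s o\<^sub>L op_powr X (t / z) o\<^sub>L op_powr (A j) s)"
    if "j \<in> {1..n}" "pos_def X" for j s and X :: "'a op"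
    using A that by (intro pos_def_sandwich pos_def_op_powr) auto
  fix X :: "'a op" assume X: "pos_def X"
  show "pos_def (renyi_map t z n w A X)"
    unfolding renyi_map_def
    by (intro pos_def_sum n pos_def_scaleR pos_def_op_powr sandwich X w_pos) auto
  show "renyi_map t z n w A X \<le>\<^sub>L renyi_map t z n w A Y" if Y: "pos_def Y" and "X \<le>\<^sub>L Y" for Y
    unfolding renyi_map_def
  proof (intro loewner_le_sum loewner_le_scaleR)
    fix j assume j: "j \<in> {1..n}"
    then show "0 \<le> w j" using w_pos by (simp add: less_imp_le)
    have XY: "op_powr X (t / z) \<le>\<^sub>L op_powr Y (t / z)"
      by (rule loewner_heinz[OF X Y \<open>X \<le>\<^sub>L Y\<close> tz])
    show "op_powr (op_powr (A j) ((1 - t) / (2 * z)) o\<^sub>L op_powr X (t / z)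
               o\<^sub>L op_powr (A j) ((1 - t) / (2 * z))) z \<le>\<^sub>L
        op_powr (op_powr (A j) ((1 - t) / (2 * z)) o\<^sub>L op_powr Y (t / z)
               o\<^sub>L op_powr (A j) ((1 - t) / (2 * z))) z"
      by (rule loewner_heinz[OF sandwich[OF j X] sandwich[OF j Y]
            loewner_le_sandwich[OF XY hermitian_op_powr]])
        (use j A t z in auto)
  qed
  show "renyi_map t z n w A (c *\<^sub>R X) = (c powr t) *\<^sub>R renyi_map t z n w A X" if "0 < c" for c
  proof -
    have "op_powr (op_powr (A j) s o\<^sub>L op_powr (c *\<^sub>R X) (t / z) o\<^sub>L op_powr (A j) s) z =
        (c powr t) *\<^sub>R op_powr (op_powr (A j) s o\<^sub>L op_powr X (t / z) o\<^sub>L op_powr (A j) s) z"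
      if "j \<in> {1..n}" for j s
      using \<open>0 < c\<close> t op_powr_scaleR[OF sandwich[OF that X], of "c powr (t / z)" s z]
      by (simp add: op_powr_scaleR X blinfun_compose_simps powr_powr)
    then show ?thesis
      unfolding renyi_map_def scaleR_sum_right by (intro sum.cong) auto
  qed
qed

lemma renyi_mean_fixpoint:
  assumes "\<forall>j\<in>{1..n}. pos_def (A j)" "prob_vector n w" "0 \<le> t" "t < z" "z \<le> 1"
  shows "pos_def (renyi_mean t z n w A)"
    and "renyi_mean t z n w A = renyi_map t z n w A (renyi_mean t z n w A)"
proof -
  interpret monotone_homogeneous_map "renyi_map t z n w A" t
    by (rule monotone_homogeneous_renyi_map[OF assms])
  have "renyi_mean t z n w A = (THE X. pos_def X \<and> X = renyi_map t z n w A X)"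
    unfolding renyi_mean_def renyi_map_def ..
  with theI'[OF fixpoint_unique_exists]
  show "pos_def (renyi_mean t z n w A)"
    "renyi_mean t z n w A = renyi_map t z n w A (renyi_mean t z n w A)"
    by auto
qed

text \<open>
  At the identity the map yields the sum whose power is the quasi-arithmetic mean.
\<close>

lemma renyi_map_id:
  assumes "\<forall>j\<in>{1..n}. pos_def (A j)" "0 < z"
  shows "renyi_map t z n w A id_blinfun = (\<Sum>j=1..n. w j *\<^sub>R op_powr (A j) (1 - t))"
proof -
  define a where "a = (1 - t) / (2 * z)"
  have a: "2 * a * z = 1 - t" using \<open>0 < z\<close> by (simp add: a_def)
  show ?thesis
    unfolding renyi_map_def a_def[symmetric] using assms(1)
    by (intro sum.cong) (simp_all add: op_powr_id op_powr_compose op_powr_powr a)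
qed

theorem theorem5p4:
  fixes n :: nat and w :: "nat \<Rightarrow> real" and A :: "nat \<Rightarrow> 'a::complex_hilbert op"
    and t z :: real
  assumes "\<forall>j\<in>{1..n}. pos_def (A j)"
    and "prob_vector n w"
    and "0 \<le> t" and "t < z" and "z \<le> 1"
  shows "(renyi_mean t z n w A \<le>\<^sub>L id_blinfun \<longrightarrow>
            op_powr (renyi_mean t z n w A) (1 / (1 - t)) \<preceq>\<^sub>N quasi_mean (1 - t) n w A) \<and>
         (id_blinfun \<le>\<^sub>L renyi_mean t z n w A \<longrightarrow>
            quasi_mean (1 - t) n w A \<preceq>\<^sub>N op_powr (renyi_mean t z n w A) (1 / (1 - t)))"
proof -
  interpret monotone_homogeneous_map "renyi_map t z n w A" t
    by (rule monotone_homogeneous_renyi_map[OF assms])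
  define X where "X = renyi_mean t z n w A"
  define S where "S = renyi_map t z n w A id_blinfun"
  have X: "pos_def X" "X = renyi_map t z n w A X"
    unfolding X_def by (rule renyi_mean_fixpoint[OF assms])+
  have S: "pos_def S" unfolding S_def by (rule pos[OF pos_def_id])
  have Q: "quasi_mean (1 - t) n w A = op_powr S (1 / (1 - t))"
    using assms by (simp add: quasi_mean_def S_def renyi_map_id)
  have r: "1 \<le> 1 / (1 - t)" using assms by simp
  have "op_powr X (1 / (1 - t)) \<preceq>\<^sub>N op_powr S (1 / (1 - t))" if "X \<le>\<^sub>L id_blinfun"
  proof -
    have "X \<le>\<^sub>L S" using mono[OF X(1) pos_def_id that] unfolding S_def X(2)[symmetric] .
    then show ?thesis by (intro near_le_powr near_le_if_loewner_le X(1) S r)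
  qed
  moreover have "op_powr S (1 / (1 - t)) \<preceq>\<^sub>N op_powr X (1 / (1 - t))" if "id_blinfun \<le>\<^sub>L X"
  proof -
    have "S \<le>\<^sub>L X" using mono[OF pos_def_id X(1) that] unfolding S_def X(2)[symmetric] .
    then show ?thesis by (intro near_le_powr near_le_if_loewner_le X(1) S r)
  qed
  ultimately show ?thesis unfolding Q X_def by blast
qed

end
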